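(* Let $D\ge 2$ be an even integer and let $d$ be a positive integer. Consider the following semidefinite program in the real variables $x^t_{i,j}$, $(i,j,t)\in\mathcal I$: maximize $\displaystyle\sum_{i=0}^{D-1}\binom{2D}{i}x^0_{i,0}+\frac12\binom{2D}{D}x^0_{D,0}$ subject to (1) $x^0_{0,0}=1$; (2) $0\le x^t_{i,j}\le x^0_{i,0}$ for all $(i,j,t)\in\mathcal I$; (3) $x^t_{i,j}=x^{t'}_{i',j'}$ whenever $(i,j,t),(i',j',t')\in\mathcal I$, $0\le i+j-2t\le D$, and $(i',j',i'+j'-2t')$ is a permutation of $(i,j,i+j-2t)$; (4) $x^t_{i,j}=x^{t'}_{i',j'}$ whenever $(i,j,t),(i',j',t')\in\mathcal I$, $D+1\le i+j-2t\le 2D-2$, and $(i',j',2D-(i'+j'-2t'))$ is a permutation of $(i,j,2D-(i+j-2t))$; (5) $x^t_{i,j}=0$ whenever $\{i,j,i+j-2t,2D-(i+j-2t)\}\cap\{1,2,\dots,d-1\}\neq\emptyset$; (6) for each even $r\in\{0,2,\dots,D\}$ the two matrices $\Big(\sum_{t}\beta^r_{i,j,t}x^t_{i,j}\Big)_{i,j=r}^{D}$ and $\Big(\sum_{t}\beta^r_{i,j,t}(x^0_{\zeta,0}-x^t_{i,j})\Big)_{i,j=r}^{D}$ are positive semidefinite, and for each odd $r\in\{1,3,\dots,D-1\}$ the two matrices $\Big(\sum_{t}\beta^r_{i,j,t}x^t_{i,j}\Big)_{i,j=r}^{D-1}$ and $\Big(\sum_{t}\beta^r_{i,j,t}(x^0_{\zeta,0}-x^t_{i,j})\Big)_{i,j=r}^{D-1}$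 are positive semidefinite; here each sum runs over all $t$ with $(i,j,t)\in\mathcal I$, and $\zeta=\min\{i+j-2t,\,2D-(i+j-2t)\}$. Then the optimal value of this semidefinite program is an upper bound on $A(\square_{2D},d)$.
   Context: Let $S=\{1,\dots,2D\}$ and let $X$ be the set of unordered pairs $\{u,u'\}$ of subsets of $S$ with $u\cap u'=\emptyset$ and $u\cup u'=S$. The folded $2D$-cube $\square_{2D}$ is the graph with vertex set $X$ whose path-length distance is $\partial(x,y)=\min\{|x_1\triangle y_1|,|x_1\triangle y_2|\}$ for $x=\{x_1,x_2\}$, $y=\{y_1,y_2\}$ (two vertices are adjacent iff this is $1$); it is distance-regular with diameter $D$. For a graph $\Gamma$, $A(\Gamma,d)$ is the maximum size of a set $C$ of vertices such that $\partial(x,y)\ge d$ for all distinct $x,y\in C$. Index set: $\mathcal I=\{(i,j,t)\in\mathbb Z^3: 0\le t\le i,j\le D,\ i+j-t\le 2D-2,\ t\ge\lfloor (j+1)/2\rfloor \text{ if } i=D,\ t\ge\lfloor (i+1)/2\rfloor\text{ if } j=D\}$. Binomial coefficients $\binom ab$ are $0$ unless $0\le b\le a$. The coefficients $\beta^r_{i,j,t}$ are: (a) for $0\le i,j\le D-1$: $\beta^r_{i,j,t}=\binom{2D-2r}{i-r}\sum_{l=0}^{D-1}(-1)^{r-l}\binom rl\binom{i-l}{t-l}\binom{2D-i-r+l}{j-r-t+l}$; (b) for $i=D$, $0\le j\le D-1$ ($r$ even): $\beta^r_{D,j,t}=2\binom{2D-2r}{D-r}\Big(\sum_{l=\lfloor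 r/2\rfloor+1}^{D-1}(-1)^{r-l}\binom rl\big(\binom{D-l}{t-l}\binom{D-r+l}{j-t-r+l}+\binom{D-r+l}{t-r+l}\binom{D-l}{j-t-l}\big)+\binom{D-r/2}{t-r/2}\binom{D-r/2}{j-t-r/2}(-1)^{r/2}\binom{r}{r/2}\Big)$; (c) for $0\le i\le D-1$, $j=D$: $\beta^r_{i,D,t}=\binom{2D-2r}{i-r}\sum_{l=0}^{D-1}(-1)^{r-l}\binom rl\big(\binom{i-l}{t-l}\binom{2D-r-i+l}{D-r-t+l}+\binom{i-l}{t}\binom{2D-r-i+l}{D-t}\big)$; (d) for $i=j=D$ and $0\le r\le D-1$ ($r$ even): $\beta^r_{D,D,t}=2\binom{2D-2r}{D-r}\Big(\sum_{l=\lfloor r/2\rfloor+1}^{D-1}2(-1)^{r-l}\binom rl\big(\binom{D-l}{t-l}\binom{D-r+l}{t}+\binom{D-l}{t}\binom{D-r+l}{D-t}\big)+2(-1)^{r/2}\binom{r}{r/2}\binom{D-r/2}{D-t}\binom{D-r/2}{t}\Big)$; (e) for $i=j=r=D$: $\beta^D_{D,D,t}=(-1)^{D-t}\binom Dt$ if $t\ge D/2+1$, and $\beta^D_{D,D,D/2}=\frac12(-1)^{D/2}\binom{D}{D/2}$.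
   Formalization: The formal program halves the coefficients β in (b),(c),(d) when i=D, 2t=j or j=D, 2t=i; adds (D,D,D/2) to the index set (new only for D=2); and exempts (0,0,0) from condition (5) (relevant only for d>2D). As printed the bound fails, e.g. for d=1. *)

theory Defs
  imports "HOL-Analysis.Analysis" "HOL-Library.Multiset"
begin

subsection \<open>Codes in the folded cube\<close>

definition folded_cube_vertices :: "nat \<Rightarrow> nat set set set" where
  "folded_cube_vertices D = {{u, u'} | u u'. u \<inter> u' = {} \<and> u \<union> u' = {1..2 * D}}"

definition folded_cube_dist :: "nat set set \<Rightarrow> nat set set \<Rightarrow> nat" where
  "folded_cube_dist x y = Min {card (sym_diff u v) | u v. u \<in> x \<and> v \<in> y}"

lemma folded_cube_dist_eq_min:
  assumes x: "x1 \<inter> x2 = {}" "x1 \<union> x2 = {1..2 * D}"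
    and y: "y1 \<inter> y2 = {}" "y1 \<union> y2 = {1..2 * D}"
  shows "folded_cube_dist {x1, x2} {y1, y2}
    = min (card (sym_diff x1 y1)) (card (sym_diff x1 y2))"
proof -
  have "sym_diff x2 y2 = sym_diff x1 y1" "sym_diff x2 y1 = sym_diff x1 y2"
    using x y by blast+
  then have "{card (sym_diff u v) | u v. u \<in> {x1, x2} \<and> v \<in> {y1, y2}}
    = {card (sym_diff x1 y1), card (sym_diff x1 y2)}"
    by (auto; metis)
  then show ?thesis
    unfolding folded_cube_dist_def by simp
qed

definition is_code :: "'v set \<Rightarrow> ('v \<Rightarrow> 'v \<Rightarrow> nat) \<Rightarrow> nat \<Rightarrow> 'v set \<Rightarrow> bool" where
  "is_code V dst d C \<longleftrightarrow> C \<subseteq> V \<and> (\<forall>x\<in>C. \<forall>y\<in>C. x \<noteq> y \<longrightarrow> d \<le> dst x y)"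

definition max_code_size :: "'v set \<Rightarrow> ('v \<Rightarrow> 'v \<Rightarrow> nat) \<Rightarrow> nat \<Rightarrow> nat" where
  "max_code_size V dst d = Max {card C | C. is_code V dst d C}"

subsection \<open>Indices and coefficients of the semidefinite program\<close>

text \<open>
  The triple \<open>(D, D, D/2)\<close> satisfies the conditions of the first set for every even \<open>D \<ge> 4\<close>.
  For \<open>D = 2\<close> it violates \<open>i + j - t \<le> 2D - 2\<close>, although the vertices given by \<open>{1,2}\<close> and
  \<open>{1,3}\<close> realise it, and without it the program does not bound the size of a code.
\<close>

definition index_set :: "nat \<Rightarrow> (nat \<times> nat \<times> nat) set" where
  "index_set D =
     {(i, j, t). t \<le> i \<and> t \<le> j \<and> i \<le> D \<and> j \<le> D \<and> i + j - t \<le> 2 * D - 2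
        \<and> (i = D \<longrightarrow> (j + 1) div 2 \<le> t) \<and> (j = D \<longrightarrow> (i + 1) div 2 \<le> t)}
     \<union> {(D, D, D div 2)}"

definition bin :: "int \<Rightarrow> int \<Rightarrow> real" where
  "bin a b = (if 0 \<le> b \<and> b \<le> a then real (nat a choose nat b) else 0)"

text \<open>
  In the exponents \<open>r - l\<close> below, truncation for \<open>l > r\<close> is harmless because the factor
  \<open>bin r l\<close> vanishes there. When \<open>i = D\<close> or \<open>j = D\<close> only even \<open>r\<close> are relevant.
\<close>

definition beta_generic :: "nat \<Rightarrow> nat \<Rightarrow> nat \<Rightarrow> nat \<Rightarrow> nat \<Rightarrow> real" where
  "beta_generic D r i j t =
    (if i < D \<and> j < D then
       bin (2 * int D - 2 * int r) (int i - int r) *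
       (\<Sum>l = 0..D - 1. (- 1) ^ (r - l) * bin (int r) (int l)
          * bin (int i - int l) (int t - int l)
          * bin (2 * int D - int i - int r + int l) (int j - int r - int t + int l))
     else if i = D \<and> j < D then
       2 * bin (2 * int D - 2 * int r) (int D - int r) *
       ((\<Sum>l = r div 2 + 1..D - 1. (- 1) ^ (r - l) * bin (int r) (int l) *
           (bin (int D - int l) (int t - int l)
              * bin (int D - int r + int l) (int j - int t - int r + int l)
            + bin (int D - int r + int l) (int t - int r + int l)
              * bin (int D - int l) (int j - int t - int l)))
        + bin (int D - int (r div 2)) (int t - int (r div 2))
          * bin (int D - int (r div 2)) (int j - int t - int (r div 2))
          * (- 1) ^ (r div 2) * bin (int r) (int (r div 2)))
     else if i < D \<and> j = D then
       bin (2 * int D - 2 * int r) (int i - int r) *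
       (\<Sum>l = 0..D - 1. (- 1) ^ (r - l) * bin (int r) (int l) *
          (bin (int i - int l) (int t - int l)
             * bin (2 * int D - int r - int i + int l) (int D - int r - int t + int l)
           + bin (int i - int l) (int t)
             * bin (2 * int D - int r - int i + int l) (int D - int t)))
     else if i = D \<and> j = D \<and> r < D then
       2 * bin (2 * int D - 2 * int r) (int D - int r) *
       ((\<Sum>l = r div 2 + 1..D - 1. 2 * (- 1) ^ (r - l) * bin (int r) (int l) *
           (bin (int D - int l) (int t - int l) * bin (int D - int r + int l) (int t)
            + bin (int D - int l) (int t) * bin (int D - int r + int l) (int D - int t)))
        + 2 * (- 1) ^ (r div 2) * bin (int r) (int (r div 2))
          * bin (int D - int (r div 2)) (int D - int t) * bin (int D - int (r div 2)) (int t))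
     else if i = D \<and> j = D \<and> r = D \<and> D div 2 \<le> t then
       (- 1) ^ (D - t) * bin (int D) (int t)
     else 0)"

text \<open>
  A vertex at distance \<open>D\<close> from \<open>{\<emptyset>, S}\<close> is a pair \<open>{u, S - u}\<close> with \<open>|u| = D\<close>, and a
  \<open>j\<close>-set meeting \<open>u\<close> in \<open>t\<close> points meets \<open>S - u\<close> in \<open>j - t\<close> points. The formulas for \<open>i = D\<close>
  or \<open>j = D\<close> add up the contributions of both members. If these intersections have the same
  size, the two contributions coincide and every pair of vertices is counted twice; the factor
  \<open>1/2\<close> undoes this. For \<open>i = j = r = D\<close> it yields the separate value at \<open>t = D/2\<close>. Without it the program is not satisfied by codes: for the code of all
  vertices and \<open>r = 0\<close>, the minor on the rows \<open>0\<close> and \<open>D\<close> would be negative.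
\<close>

definition beta :: "nat \<Rightarrow> nat \<Rightarrow> nat \<Rightarrow> nat \<Rightarrow> nat \<Rightarrow> real" where
  "beta D r i j t =
    (if (i = D \<and> 2 * t = j) \<or> (j = D \<and> 2 * t = i) then 1 / 2 else 1) * beta_generic D r i j t"

subsection \<open>The semidefinite program\<close>

definition psd_on :: "nat set \<Rightarrow> (nat \<Rightarrow> nat \<Rightarrow> real) \<Rightarrow> bool" where
  "psd_on J M \<longleftrightarrow> (\<forall>i\<in>J. \<forall>j\<in>J. M i j = M j i)
     \<and> (\<forall>v :: nat \<Rightarrow> real. 0 \<le> (\<Sum>i\<in>J. \<Sum>j\<in>J. v i * M i j * v j))"

definition zeta :: "nat \<Rightarrow> nat \<Rightarrow> nat \<Rightarrow> nat \<Rightarrow> nat" where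
  "zeta D i j t = min (i + j - 2 * t) (2 * D - (i + j - 2 * t))"

definition block1 :: "nat \<Rightarrow> (nat \<Rightarrow> nat \<Rightarrow> nat \<Rightarrow> real) \<Rightarrow> nat \<Rightarrow> nat \<Rightarrow> nat \<Rightarrow> real" where
  "block1 D x r i j = (\<Sum>t | (i, j, t) \<in> index_set D. beta D r i j t * x i j t)"

definition block2 :: "nat \<Rightarrow> (nat \<Rightarrow> nat \<Rightarrow> nat \<Rightarrow> real) \<Rightarrow> nat \<Rightarrow> nat \<Rightarrow> nat \<Rightarrow> real" where
  "block2 D x r i j =
     (\<Sum>t | (i, j, t) \<in> index_set D. beta D r i j t * (x (zeta D i j t) 0 0 - x i j t))"

text \<open>
  The variable with lower indices \<open>i, j\<close> and upper index \<open>t\<close> is \<open>x i j t\<close>; values outside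
  \<open>index_set D\<close> play no role. In the fifth condition the exception for \<open>(0, 0, 0)\<close> is vacuous
  for \<open>d \<le> 2D\<close>; for \<open>d > 2D\<close> the condition would otherwise contradict \<open>x 0 0 0 = 1\<close>, since then
  \<open>2D - 0\<close> lies in \<open>{1..d - 1}\<close>.
\<close>

definition sdp_feasible :: "nat \<Rightarrow> nat \<Rightarrow> (nat \<Rightarrow> nat \<Rightarrow> nat \<Rightarrow> real) \<Rightarrow> bool" where
  "sdp_feasible D d x \<longleftrightarrow>
     x 0 0 0 = 1
   \<and> (\<forall>(i, j, t) \<in> index_set D. 0 \<le> x i j t \<and> x i j t \<le> x i 0 0)
   \<and> (\<forall>(i, j, t) \<in> index_set D. \<forall>(i', j', t') \<in> index_set D.
        i + j - 2 * t \<le> D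
        \<and> mset [i', j', i' + j' - 2 * t'] = mset [i, j, i + j - 2 * t]
        \<longrightarrow> x i j t = x i' j' t')
   \<and> (\<forall>(i, j, t) \<in> index_set D. \<forall>(i', j', t') \<in> index_set D.
        D + 1 \<le> i + j - 2 * t \<and> i + j - 2 * t \<le> 2 * D - 2
        \<and> mset [i', j', 2 * D - (i' + j' - 2 * t')] = mset [i, j, 2 * D - (i + j - 2 * t)]
        \<longrightarrow> x i j t = x i' j' t')
   \<and> (\<forall>(i, j, t) \<in> index_set D.
        (i, j, t) \<noteq> (0, 0, 0)
        \<and> {i, j, i + j - 2 * t, 2 * D - (i + j - 2 * t)} \<inter> {1..d - 1} \<noteq> {}
        \<longrightarrow> x i j t = 0)
   \<and> (\<forall>r \<in> {0..D}. even r \<longrightarrow> psd_on {r..D} (block1 D x r) \<and> psd_on {r..D} (block2 D x r))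
   \<and> (\<forall>r \<in> {1..D - 1}. odd r \<longrightarrow>
        psd_on {r..D - 1} (block1 D x r) \<and> psd_on {r..D - 1} (block2 D x r))"

definition sdp_objective :: "nat \<Rightarrow> (nat \<Rightarrow> nat \<Rightarrow> nat \<Rightarrow> real) \<Rightarrow> real" where
  "sdp_objective D x =
     (\<Sum>i = 0..D - 1. real (2 * D choose i) * x i 0 0) + 1 / 2 * real (2 * D choose D) * x D 0 0"

definition sdp_value :: "nat \<Rightarrow> nat \<Rightarrow> ereal" where
  "sdp_value D d = (SUP x \<in> {x. sdp_feasible D d x}. ereal (sdp_objective D x))"

end

theory Submission
  imports Defs "HOL-Combinatorics.Permutations"
begin

text \<open>
  An optimal code \<open>C\<close> lifts to the set \<open>B = \<Union>C\<close> of subsets of \<open>S = {1..2D}\<close>, which is closed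
  under complement. Averaging the indicator of \<open>a \<triangle> p u \<in> B \<and> a \<triangle> p v \<in> B\<close> over all
  permutations \<open>p\<close> of \<open>S\<close> and all \<open>a \<in> B\<close> gives a positive semidefinite kernel in \<open>u, v\<close> that
  depends only on \<open>(|u|, |v|, |u \<inter> v|)\<close>; its values are the feasible point. Averaging over
  \<open>a \<notin> B\<close> instead gives the kernel of the second family of blocks.

  No block diagonalisation is needed. Choose \<open>r\<close> disjoint pairs of points of \<open>S\<close> and let \<open>g u\<close> be
  the product over these pairs \<open>(x, x')\<close> of \<open>[x \<in> u] - [x' \<in> u]\<close>. The numbers \<open>2\<^sup>r \<beta>\<close> are the
  sums of \<open>g u * g v\<close> over the pairs with \<open>|u| = i\<close>, \<open>|v| = j\<close>, \<open>|u \<inter> v| = t\<close>, up to the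
  identification of \<open>t\<close> with \<open>j - t\<close> when \<open>i = D\<close>. So each block is essentially a Gram matrix of
  the kernel, taken at the restrictions of \<open>g\<close> to the \<open>i\<close>-subsets for varying \<open>i\<close>.
\<close>

section \<open>Positive semidefinite kernels\<close>

definition psd_kernel :: "'a set \<Rightarrow> ('a \<Rightarrow> 'a \<Rightarrow> real) \<Rightarrow> bool" where
  "psd_kernel U K \<longleftrightarrow> (\<forall>u\<in>U. \<forall>v\<in>U. K u v = K v u)
     \<and> (\<forall>f. 0 \<le> (\<Sum>u\<in>U. \<Sum>v\<in>U. f u * K u v * f v))"

lemma psd_kernelI:
  assumes "\<And>u v. u \<in> U \<Longrightarrow> v \<in> U \<Longrightarrow> K u v = K v u"
    and "\<And>f. 0 \<le> (\<Sum>u\<in>U. \<Sum>v\<in>U. f u * K u v * f v)"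
  shows "psd_kernel U K"
  using assms unfolding psd_kernel_def by blast

lemma psd_kernel_commute: "psd_kernel U K \<Longrightarrow> u \<in> U \<Longrightarrow> v \<in> U \<Longrightarrow> K u v = K v u"
  unfolding psd_kernel_def by blast

lemma psd_kernel_quadratic_nonneg:
  "psd_kernel U K \<Longrightarrow> 0 \<le> (\<Sum>u\<in>U. \<Sum>v\<in>U. f u * K u v * f v)"
  unfolding psd_kernel_def by blast

lemma psd_on_iff_psd_kernel: "psd_on J M \<longleftrightarrow> psd_kernel J M"
  unfolding psd_on_def psd_kernel_def ..

lemma psd_kernel_cong:
  assumes "\<And>u v. u \<in> U \<Longrightarrow> v \<in> U \<Longrightarrow> K u v = L u v"
  shows "psd_kernel U K \<longleftrightarrow> psd_kernel U L"
  unfolding psd_kernel_def using assms by (simp cong: sum.cong)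

lemma psd_kernel_rank_one: "psd_kernel U (\<lambda>u v. h u * h v)"
proof (rule psd_kernelI)
  fix f
  have "(\<Sum>u\<in>U. \<Sum>v\<in>U. f u * (h u * h v) * f v) = (\<Sum>u\<in>U. f u * h u)\<^sup>2"
    by (simp add: power2_eq_square sum_product mult_ac)
  then show "0 \<le> (\<Sum>u\<in>U. \<Sum>v\<in>U. f u * (h u * h v) * f v)" by simp
qed (rule mult.commute)

lemma psd_kernel_sum:
  assumes "\<And>x. x \<in> X \<Longrightarrow> psd_kernel U (K x)"
  shows "psd_kernel U (\<lambda>u v. \<Sum>x\<in>X. K x u v)"
proof (rule psd_kernelI)
  show "(\<Sum>x\<in>X. K x u v) = (\<Sum>x\<in>X. K x v u)" if "u \<in> U" "v \<in> U" for u v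
    using assms that by (intro sum.cong refl psd_kernel_commute)
  fix f
  have "(\<Sum>u\<in>U. \<Sum>v\<in>U. f u * (\<Sum>x\<in>X. K x u v) * f v)
      = (\<Sum>u\<in>U. \<Sum>v\<in>U. \<Sum>x\<in>X. f u * K x u v * f v)"
    by (simp add: sum_distrib_left sum_distrib_right)
  also have "\<dots> = (\<Sum>u\<in>U. \<Sum>x\<in>X. \<Sum>v\<in>U. f u * K x u v * f v)"
    by (intro sum.cong refl sum.swap)
  also have "\<dots> = (\<Sum>x\<in>X. \<Sum>u\<in>U. \<Sum>v\<in>U. f u * K x u v * f v)"
    by (rule sum.swap)
  also have "\<dots> \<ge> 0"
    by (intro sum_nonneg psd_kernel_quadratic_nonneg assms)
  finally show "0 \<le> (\<Sum>u\<in>U. \<Sum>v\<in>U. f u * (\<Sum>x\<in>X. K x u v) * f v)" .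
qed

lemma psd_kernel_add:
  assumes "psd_kernel U K" "psd_kernel U L"
  shows "psd_kernel U (\<lambda>u v. K u v + L u v)"
proof (rule psd_kernelI)
  show "K u v + L u v = K v u + L v u" if "u \<in> U" "v \<in> U" for u v
    using psd_kernel_commute[OF assms(1) that] psd_kernel_commute[OF assms(2) that] by simp
  show "0 \<le> (\<Sum>u\<in>U. \<Sum>v\<in>U. f u * (K u v + L u v) * f v)" for f
    using psd_kernel_quadratic_nonneg[OF assms(1), of f]
      psd_kernel_quadratic_nonneg[OF assms(2), of f]
    by (simp add: distrib_left distrib_right sum.distrib)
qed

lemma psd_kernel_mult_left:
  assumes "psd_kernel U K" "0 \<le> c"
  shows "psd_kernel U (\<lambda>u v. c * K u v)"
proof (rule psd_kernelI)
  show "c * K u v = c * K v u" if "u \<in> U" "v \<in> U" for u v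
    using psd_kernel_commute[OF assms(1) that] by simp
  fix f
  have "(\<Sum>u\<in>U. \<Sum>v\<in>U. f u * (c * K u v) * f v) = c * (\<Sum>u\<in>U. \<Sum>v\<in>U. f u * K u v * f v)"
    by (simp add: sum_distrib_left mult_ac)
  then show "0 \<le> (\<Sum>u\<in>U. \<Sum>v\<in>U. f u * (c * K u v) * f v)"
    using psd_kernel_quadratic_nonneg[OF assms(1)] assms(2) by simp
qed

lemma psd_kernel_congruence:
  assumes "psd_kernel U K"
  shows "psd_kernel I (\<lambda>i j. \<Sum>u\<in>U. \<Sum>v\<in>U. h i u * K u v * h j v)"
proof (rule psd_kernelI)
  let ?Q = "\<lambda>i j. \<Sum>u\<in>U. \<Sum>v\<in>U. h i u * K u v * h j v"
  show "?Q i j = ?Q j i" for i j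
  proof -
    have "?Q i j = (\<Sum>u\<in>U. \<Sum>v\<in>U. h j v * K v u * h i u)"
      using psd_kernel_commute[OF assms] by (intro sum.cong refl) simp
    also have "\<dots> = ?Q j i" by (rule sum.swap)
    finally show ?thesis .
  qed
  fix f :: "'b \<Rightarrow> real"
  define g where "g u = (\<Sum>i\<in>I. f i * h i u)" for u
  have collect: "(\<Sum>i\<in>I. f i * (\<Sum>u\<in>U. h i u * X u)) = (\<Sum>u\<in>U. g u * X u)" for X
    unfolding g_def sum_distrib_left sum_distrib_right mult.assoc by (rule sum.swap)
  have "(\<Sum>i\<in>I. \<Sum>j\<in>I. f i * ?Q i j * f j)
      = (\<Sum>i\<in>I. \<Sum>j\<in>I. \<Sum>u\<in>U. \<Sum>v\<in>U. f i * h i u * (f j * h j v * K u v))"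
    by (simp add: sum_distrib_left sum_distrib_right mult_ac)
  also have "\<dots> = (\<Sum>i\<in>I. \<Sum>u\<in>U. \<Sum>j\<in>I. \<Sum>v\<in>U. f i * h i u * (f j * h j v * K u v))"
    by (intro sum.cong refl sum.swap)
  also have "\<dots> = (\<Sum>i\<in>I. f i * (\<Sum>u\<in>U. h i u * (\<Sum>j\<in>I. f j * (\<Sum>v\<in>U. h j v * K u v))))"
    by (simp only: sum_distrib_left mult.assoc)
  also have "\<dots> = (\<Sum>u\<in>U. \<Sum>v\<in>U. g u * K u v * g v)"
    unfolding collect by (simp add: sum_distrib_left mult_ac)
  also have "\<dots> \<ge> 0" by (rule psd_kernel_quadratic_nonneg[OF assms])
  finally show "0 \<le> (\<Sum>i\<in>I. \<Sum>j\<in>I. f i * ?Q i j * f j)" .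
qed

lemma psd_kernel_rescale:
  assumes "psd_kernel U K"
  shows "psd_kernel U (\<lambda>u v. h u * K u v * h v)"
proof (rule psd_kernelI)
  show "h u * K u v * h v = h v * K v u * h u" if "u \<in> U" "v \<in> U" for u v
    using psd_kernel_commute[OF assms that] by simp
  fix f
  show "0 \<le> (\<Sum>u\<in>U. \<Sum>v\<in>U. f u * (h u * K u v * h v) * f v)"
    using psd_kernel_quadratic_nonneg[OF assms, of "\<lambda>u. f u * h u"] by (simp add: mult_ac)
qed

section \<open>The averaged kernel of a code\<close>

definition pair_orbit :: "'a set \<Rightarrow> nat \<Rightarrow> nat \<Rightarrow> nat \<Rightarrow> ('a set \<times> 'a set) set" where
  "pair_orbit S i j t = {(u, v). u \<subseteq> S \<and> v \<subseteq> S \<and> card u = i \<and> card v = j \<and> card (u \<inter> v) = t}"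

lemma pair_orbit_swap: "(u, v) \<in> pair_orbit S i j t \<longleftrightarrow> (v, u) \<in> pair_orbit S j i t"
  unfolding pair_orbit_def by (auto simp: Int_commute)

lemma pair_orbit_bounds:
  assumes "finite S" "(u, v) \<in> pair_orbit S i j t"
  shows "t \<le> i" "t \<le> j" "i + j - t \<le> card S"
proof -
  have fin: "finite u" "finite v" and union_subset: "u \<union> v \<subseteq> S"
    using assms by (auto simp: pair_orbit_def intro: finite_subset)
  have "card (u \<inter> v) \<le> card u" "card (u \<inter> v) \<le> card v" "card (u \<union> v) \<le> card S"
    using fin card_mono[OF assms(1) union_subset] by (simp_all add: card_mono)
  then show "t \<le> i" "t \<le> j" "i + j - t \<le> card S"
    using assms(2) card_Un_Int[OF fin] by (simp_all add: pair_orbit_def)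
qed

lemma pair_orbit_Diff:
  assumes finite_S: "finite S" and uv: "(u, v) \<in> pair_orbit S i j t"
  shows "(S - u, v) \<in> pair_orbit S (card S - i) j (j - t)"
proof -
  have subset_S: "u \<subseteq> S" "v \<subseteq> S" and cards: "card u = i" "card v = j" "card (u \<inter> v) = t"
    using uv by (simp_all add: pair_orbit_def)
  have fin: "finite u" "finite v" using subset_S finite_S finite_subset by auto
  have "card (S - u) = card S - i" using subset_S(1) fin(1) cards(1) by (simp add: card_Diff_subset)
  moreover have "(S - u) \<inter> v = v - u \<inter> v" using subset_S by blast
  then have "card ((S - u) \<inter> v) = j - t" using fin cards by (simp add: card_Diff_subset)
  ultimately show ?thesis using subset_S cards by (simp add: pair_orbit_def)
qed

lemma ex_in_pair_orbit:
  assumes "t \<le> i" "t \<le> j" "i + j - t \<le> n"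
  shows "({1..i}, {1..t} \<union> {i + 1..i + j - t}) \<in> pair_orbit {1..n} i j t"
proof -
  let ?v = "{1..t} \<union> {i + 1..i + j - t}"
  have "card ?v = j" using assms by (subst card_Un_disjoint) auto
  moreover have "{1..i} \<inter> ?v = {1..t}" using assms by auto
  ultimately show ?thesis unfolding pair_orbit_def using assms by auto
qed

lemma card_sym_diff:
  assumes "finite u" "finite v"
  shows "card (sym_diff u v) + 2 * card (u \<inter> v) = card u + card v"
proof -
  have "card (sym_diff u v) = card (u - v) + card (v - u)"
    using assms by (intro card_Un_disjoint) auto
  then show ?thesis
    using card_Int_Diff[OF assms(1), of v] card_Int_Diff[OF assms(2), of u]
    by (simp add: Int_commute)
qed

lemma card_sym_diff_pair_orbit:
  assumes "finite S" "(u, v) \<in> pair_orbit S i j t"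
  shows "card (sym_diff u v) = i + j - 2 * t"
proof -
  have "finite u" "finite v" using assms by (auto simp: pair_orbit_def intro: finite_subset)
  from card_sym_diff[OF this] show ?thesis using assms(2) by (simp add: pair_orbit_def)
qed

lemma in_pair_orbit_if_card_sym_diff:
  assumes "finite S" "u \<subseteq> S" "v \<subseteq> S" "card (sym_diff u v) = card u + card v - 2 * t"
    and "t \<le> card u" "t \<le> card v"
  shows "(u, v) \<in> pair_orbit S (card u) (card v) t"
proof -
  have "finite u" "finite v" using assms by (auto intro: finite_subset)
  from card_sym_diff[OF this] show ?thesis using assms by (simp add: pair_orbit_def)
qed

lemma ex_permutes_eq_comp:
  assumes "finite S" "\<And>c. card {x \<in> S. f x = c} = card {x \<in> S. g x = c}"
  obtains p where "p permutes S" "\<And>x. x \<in> S \<Longrightarrow> f x = g (p x)"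
proof -
  have count: "count (image_mset h (mset_set S)) c = card {x \<in> S. h x = c}" for h :: "'a \<Rightarrow> 'b" and c
    using assms(1) by (simp add: count_image_mset vimage_def Int_def conj_commute)
  have "image_mset f (mset_set S) = image_mset g (mset_set S)"
    by (rule multiset_eqI) (simp only: count assms(2))
  from image_mset_eq_implies_permutes[OF assms(1) this] obtain p
    where "p permutes S" "\<forall>x\<in>S. f x = g (p x)" .
  then show thesis by (intro that) auto
qed

lemma card_membership_class:
  assumes finite_S: "finite S" and uv: "(u, v) \<in> pair_orbit S i j t"
  shows "card {x \<in> S. (x \<in> u, x \<in> v) = (a, b)}
    = (if a \<and> b then t else if a then i - t else if b then j - t else card S - (i + j - t))"
proof -
  have subset_S: "u \<subseteq> S" "v \<subseteq> S" and cards: "card u = i" "card v = j" "card (u \<inter> v) = t"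
    using uv by (simp_all add: pair_orbit_def)
  have fin: "finite u" "finite v" using subset_S finite_S finite_subset by auto
  have "{x \<in> S. (x \<in> u, x \<in> v) = (True, True)} = u \<inter> v"
    "{x \<in> S. (x \<in> u, x \<in> v) = (True, False)} = u - u \<inter> v"
    "{x \<in> S. (x \<in> u, x \<in> v) = (False, True)} = v - u \<inter> v"
    "{x \<in> S. (x \<in> u, x \<in> v) = (False, False)} = S - (u \<union> v)"
    using subset_S by auto
  moreover have "card (u \<union> v) = i + j - t"
    using card_Un_Int[OF fin] cards by linarith
  ultimately show ?thesis
    using fin subset_S finite_S cards by (cases a; cases b) (simp_all add: card_Diff_subset)
qed

lemma pair_orbit_transitive:
  assumes finite_S: "finite S"
    and orbits: "(u, v) \<in> pair_orbit S i j t" "(u', v') \<in> pair_orbit S i j t"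
  obtains p where "p permutes S" "p ` u = u'" "p ` v = v'"
proof -
  obtain p where permutes: "p permutes S"
    and class_eq: "\<And>x. x \<in> S \<Longrightarrow> (x \<in> u, x \<in> v) = (p x \<in> u', p x \<in> v')"
  proof (rule ex_permutes_eq_comp[OF finite_S])
    show "card {x \<in> S. (x \<in> u, x \<in> v) = c} = card {x \<in> S. (x \<in> u', x \<in> v') = c}" for c
      by (cases c) (simp only: card_membership_class[OF finite_S orbits(1)]
          card_membership_class[OF finite_S orbits(2)])
  qed (use that in blast)
  have image_eq: "p ` a = a'" if "a \<subseteq> S" "a' \<subseteq> S" "\<And>x. x \<in> S \<Longrightarrow> x \<in> a \<longleftrightarrow> p x \<in> a'" for a a'
  proof -
    have "a' \<subseteq> p ` S" using that(2) permutes_image[OF permutes] by simp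
    then show ?thesis using that(1,3) by fast
  qed
  have "p ` u = u'" by (rule image_eq) (use orbits class_eq in \<open>auto simp: pair_orbit_def\<close>)
  moreover have "p ` v = v'" by (rule image_eq) (use orbits class_eq in \<open>auto simp: pair_orbit_def\<close>)
  ultimately show thesis using that permutes by blast
qed

definition translate_count :: "'a set set \<Rightarrow> 'a set set \<Rightarrow> 'a set \<Rightarrow> 'a set \<Rightarrow> nat" where
  "translate_count A B u v = card {a \<in> A. sym_diff a u \<in> B \<and> sym_diff a v \<in> B}"

lemma translate_count_commute: "translate_count A B u v = translate_count A B v u"
  unfolding translate_count_def by (simp only: conj_commute)

lemma sym_diff_cancel: "sym_diff (sym_diff a b) b = a"
  by blast

lemma card_Collect_sym_diff: "card {a. P (sym_diff a w)} = card {a. P a}"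
proof (rule bij_betw_same_card)
  show "bij_betw (\<lambda>a. sym_diff a w) {a. P (sym_diff a w)} {a. P a}"
    by (rule bij_betw_byWitness[where f' = "\<lambda>a. sym_diff a w"])
      (auto simp only: sym_diff_cancel mem_Collect_eq)
qed

lemma translate_count_sym_diff:
  "translate_count B B (sym_diff u v) v = translate_count B B u v"
proof -
  let ?P = "\<lambda>a. a \<in> B \<and> sym_diff a u \<in> B \<and> sym_diff a v \<in> B"
  have "sym_diff (sym_diff a v) u = sym_diff a (sym_diff u v)" for a by blast
  then have "?P (sym_diff a v) \<longleftrightarrow> a \<in> B \<and> sym_diff a (sym_diff u v) \<in> B \<and> sym_diff a v \<in> B" for a
    by (simp only: sym_diff_cancel conj_ac)
  then show ?thesis
    using card_Collect_sym_diff[of ?P v] unfolding translate_count_def by simp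
qed

lemma translate_count_Pow:
  assumes "B \<subseteq> Pow S" "v \<subseteq> S"
  shows "translate_count (Pow S) B u v = translate_count B B (sym_diff u v) {}"
proof -
  let ?P = "\<lambda>a. a \<in> B \<and> sym_diff a (sym_diff u v) \<in> B"
  have "sym_diff (sym_diff a v) (sym_diff u v) = sym_diff a u" for a by blast
  moreover have "a \<subseteq> S" if "sym_diff a v \<in> B" for a using that assms by blast
  ultimately have "?P (sym_diff a v) \<longleftrightarrow> a \<in> Pow S \<and> sym_diff a u \<in> B \<and> sym_diff a v \<in> B" for a
    by (metis Pow_iff)
  then show ?thesis
    using card_Collect_sym_diff[of ?P v] unfolding translate_count_def by (simp add: conj_ac)
qed

lemma translate_count_Diff:
  assumes "finite A" "A' \<subseteq> A"
  shows "real (translate_count (A - A') B u v)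
    = real (translate_count A B u v) - real (translate_count A' B u v)"
proof -
  let ?T = "\<lambda>A. {a \<in> A. sym_diff a u \<in> B \<and> sym_diff a v \<in> B}"
  have "?T (A - A') = ?T A - ?T A'" "?T A' \<subseteq> ?T A" using assms(2) by auto
  then show ?thesis
    unfolding translate_count_def using assms(1)
    by (simp add: card_Diff_subset card_mono finite_subset of_nat_diff)
qed

lemma translate_count_complement:
  assumes "A \<subseteq> Pow S" "\<And>b. b \<in> B \<Longrightarrow> S - b \<in> B" "u \<subseteq> S"
  shows "translate_count A B (S - u) v = translate_count A B u v"
proof -
  have "sym_diff a (S - u) \<in> B \<longleftrightarrow> sym_diff a u \<in> B" if "a \<in> A" for a
  proof -
    have "sym_diff a (S - u) = S - sym_diff a u" "sym_diff a u = S - sym_diff a (S - u)"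
      using that assms(1,3) by blast+
    then show ?thesis using assms(2) by metis
  qed
  then show ?thesis unfolding translate_count_def by (intro arg_cong[where f = card]) auto
qed

lemma sum_translate_count:
  assumes "finite S" "B \<subseteq> Pow S"
  shows "(\<Sum>u\<in>Pow S. translate_count B B u {}) = (card B)\<^sup>2"
proof -
  have fin: "finite B" "finite (Pow S)" using assms finite_subset by auto
  have "(\<Sum>u\<in>Pow S. translate_count B B u {}) = (\<Sum>u\<in>Pow S. \<Sum>a\<in>B. of_bool (sym_diff u a \<in> B))"
    using fin(1) by (intro sum.cong refl) (simp add: translate_count_def Int_def Un_commute conj_ac)
  also have "\<dots> = (\<Sum>a\<in>B. \<Sum>u\<in>Pow S. of_bool (sym_diff u a \<in> B))"
    by (rule sum.swap)
  also have "\<dots> = (\<Sum>a\<in>B. card B)"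
  proof (rule sum.cong)
    fix a assume "a \<in> B"
    then have "Pow S \<inter> {u. sym_diff u a \<in> B} = {u. sym_diff u a \<in> B}" using assms(2) by blast
    then show "(\<Sum>u\<in>Pow S. of_bool (sym_diff u a \<in> B)) = card B"
      using fin(2) card_Collect_sym_diff[of "\<lambda>u. u \<in> B" a] by simp
  qed simp
  finally show ?thesis by (simp add: power2_eq_square)
qed

lemma psd_kernel_translate_count:
  assumes "finite A"
  shows "psd_kernel U (\<lambda>u v. real (translate_count A B (h u) (h v)))"
proof -
  have "real (translate_count A B u v)
      = (\<Sum>a\<in>A. of_bool (sym_diff a u \<in> B) * of_bool (sym_diff a v \<in> B))" for u v
    using assms by (simp add: translate_count_def Int_def conj_ac flip: of_bool_conj)
  then show ?thesis by (simp only: psd_kernel_sum psd_kernel_rank_one)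
qed

text \<open>
  The probability that \<open>a \<triangle> p u\<close> and \<open>a \<triangle> p v\<close> both lie in \<open>B\<close>, for a random permutation \<open>p\<close> of \<open>S\<close>
  and random \<open>a \<in> A\<close>, up to the factor \<open>|A| / |B|\<close>.
\<close>

definition code_kernel :: "'a set \<Rightarrow> 'a set set \<Rightarrow> 'a set set \<Rightarrow> 'a set \<Rightarrow> 'a set \<Rightarrow> real" where
  "code_kernel S A B u v =
    (\<Sum>p | p permutes S. real (translate_count A B (p ` u) (p ` v)))
      / (fact (card S) * real (card B))"

lemma code_kernel_commute: "code_kernel S A B u v = code_kernel S A B v u"
  unfolding code_kernel_def by (simp only: translate_count_commute)

lemma code_kernel_nonneg: "0 \<le> code_kernel S A B u v"
  unfolding code_kernel_def by (simp add: sum_nonneg)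

lemma psd_kernel_code_kernel:
  assumes "finite A"
  shows "psd_kernel U (code_kernel S A B)"
proof -
  have "psd_kernel U (\<lambda>u v. inverse (fact (card S) * real (card B))
      * (\<Sum>p | p permutes S. real (translate_count A B (p ` u) (p ` v))))"
    by (intro psd_kernel_mult_left psd_kernel_sum psd_kernel_translate_count assms) simp
  then show ?thesis unfolding code_kernel_def by (simp add: divide_inverse_commute)
qed

lemma code_kernel_cong_orbit:
  assumes "finite S" "(u, v) \<in> pair_orbit S i j t" "(u', v') \<in> pair_orbit S i j t"
  shows "code_kernel S A B u v = code_kernel S A B u' v'"
proof -
  obtain q where permutes_image_eq: "q permutes S" "q ` u = u'" "q ` v = v'"
    using pair_orbit_transitive[OF assms] .
  have "(\<Sum>p | p permutes S. real (translate_count A B (p ` u) (p ` v)))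
      = (\<Sum>p | p permutes S. real (translate_count A B (p ` u') (p ` v')))"
    by (subst sum_permutations_compose_right[OF permutes_image_eq(1)])
      (simp add: image_comp flip: permutes_image_eq(2,3))
  then show ?thesis unfolding code_kernel_def by simp
qed

lemma permutes_image_sym_diff:
  "p permutes S \<Longrightarrow> p ` sym_diff u v = sym_diff (p ` u) (p ` v)"
  by (simp add: image_Un image_set_diff permutes_inj)

lemma permutes_image_Diff:
  "p permutes S \<Longrightarrow> p ` (S - u) = S - p ` u"
  by (simp add: image_set_diff permutes_inj permutes_image)

lemma permutes_image_subset:
  "p permutes S \<Longrightarrow> u \<subseteq> S \<Longrightarrow> p ` u \<subseteq> S"
  using permutes_image by blast

lemma code_kernel_sym_diff: "code_kernel S B B (sym_diff u v) v = code_kernel S B B u v"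
proof -
  have "translate_count B B (p ` sym_diff u v) (p ` v) = translate_count B B (p ` u) (p ` v)"
    if "p permutes S" for p
    unfolding permutes_image_sym_diff[OF that] by (rule translate_count_sym_diff)
  then show ?thesis unfolding code_kernel_def by simp
qed

lemma code_kernel_complement:
  assumes "A \<subseteq> Pow S" "\<And>b. b \<in> B \<Longrightarrow> S - b \<in> B" "u \<subseteq> S"
  shows "code_kernel S A B (S - u) v = code_kernel S A B u v"
proof -
  have "translate_count A B (p ` (S - u)) (p ` v) = translate_count A B (p ` u) (p ` v)"
    if "p permutes S" for p
    using translate_count_complement[OF assms(1,2) permutes_image_subset[OF that assms(3)]]
    by (simp add: permutes_image_Diff[OF that])
  then show ?thesis unfolding code_kernel_def by simp
qed

lemma code_kernel_Pow_Diff: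
  assumes "finite S" "B \<subseteq> Pow S" "v \<subseteq> S"
  shows "code_kernel S (Pow S - B) B u v
    = code_kernel S B B (sym_diff u v) {} - code_kernel S B B u v"
proof -
  have "real (translate_count (Pow S - B) B (p ` u) (p ` v))
      = real (translate_count B B (p ` sym_diff u v) (p ` {}))
        - real (translate_count B B (p ` u) (p ` v))"
    if "p permutes S" for p
    using assms(1) translate_count_Diff[OF _ assms(2)]
      translate_count_Pow[OF assms(2) permutes_image_subset[OF that assms(3)]]
    by (simp add: permutes_image_sym_diff[OF that])
  then show ?thesis
    unfolding code_kernel_def by (simp add: sum_subtractf diff_divide_distrib)
qed

lemma code_kernel_le_empty:
  assumes "finite B"
  shows "code_kernel S B B u v \<le> code_kernel S B B u {}"
proof -
  have "translate_count B B u' v' \<le> translate_count B B u' {}" for u' v'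
    unfolding translate_count_def using assms by (intro card_mono) auto
  then show ?thesis
    unfolding code_kernel_def by (intro divide_right_mono sum_mono) simp_all
qed

lemma code_kernel_empty_empty:
  assumes "finite S" "finite B" "B \<noteq> {}"
  shows "code_kernel S B B {} {} = 1"
  using assms card_permutations[OF refl assms(1)]
  by (simp add: code_kernel_def translate_count_def card_gt_0_iff)

lemma sum_code_kernel_empty:
  assumes "finite S" "B \<subseteq> Pow S"
  shows "(\<Sum>u\<in>Pow S. code_kernel S B B u {}) = card B"
proof -
  have "(\<Sum>u\<in>Pow S. real (translate_count B B (p ` u) {})) = (real (card B))\<^sup>2"
    if "p permutes S" for p
  proof -
    have "(\<Sum>u\<in>Pow S. real (translate_count B B (p ` u) {}))
        = (\<Sum>u\<in>Pow S. real (translate_count B B u {}))"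
      using bij_betw_Pow[OF permutes_imp_bij[OF that]] by (rule sum.reindex_bij_betw)
    then show ?thesis using sum_translate_count[OF assms] by (simp flip: of_nat_sum of_nat_power)
  qed
  then have "(\<Sum>p | p permutes S. \<Sum>u\<in>Pow S. real (translate_count B B (p ` u) {}))
      = fact (card S) * (real (card B))\<^sup>2"
    using card_permutations[OF refl assms(1)] by simp
  then show ?thesis
    unfolding code_kernel_def sum_divide_distrib[symmetric] sum.swap[of _ "Pow S"]
    by (simp add: power2_eq_square)
qed

lemma code_kernel_nonzeroE:
  assumes "code_kernel S A B u v \<noteq> 0"
  obtains a b c where "a \<in> A" "b \<in> B" "c \<in> B" "card (sym_diff a b) = card u"
    "card (sym_diff a c) = card v" "card (sym_diff b c) = card (sym_diff u v)"
proof -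
  obtain p where permutes: "p permutes S" and "translate_count A B (p ` u) (p ` v) \<noteq> 0"
    using assms unfolding code_kernel_def by (auto elim!: sum.not_neutral_contains_not_neutral)
  then obtain a where translates: "a \<in> A" "sym_diff a (p ` u) \<in> B" "sym_diff a (p ` v) \<in> B"
    unfolding translate_count_def by (metis (mono_tags, lifting) card.empty empty_Collect_eq)
  let ?b = "sym_diff a (p ` u)" and ?c = "sym_diff a (p ` v)"
  have "sym_diff a ?b = p ` u" "sym_diff a ?c = p ` v" "sym_diff ?b ?c = p ` sym_diff u v"
    unfolding permutes_image_sym_diff[OF permutes] by blast+
  moreover have "card (p ` x) = card x" for x
    using permutes_inj[OF permutes] by (intro card_image) (auto simp: inj_on_def)
  ultimately show thesis using translates by (intro that[of a ?b ?c]) auto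
qed

section \<open>Signed sums over pairs of sets\<close>

lemma bin_symmetric: "bin a b = bin a (a - b)"
  by (auto simp: bin_def nat_diff_distrib binomial_symmetric[of "nat b" "nat a"])

lemma bin_int_symmetric: "l \<le> r \<Longrightarrow> bin (int r) (int (r - l)) = bin (int r) (int l)"
  by (subst (2) bin_symmetric) (simp add: of_nat_diff)

lemma bin_eq_0: "a < b \<Longrightarrow> bin a b = 0"
  by (simp add: bin_def)

lemma card_subsets_eq_bin:
  assumes "finite X"
  shows "real (card {a. a \<subseteq> X \<and> int (card a) = z}) = bin (int (card X)) z"
proof (cases "0 \<le> z")
  case True
  then have "{a. a \<subseteq> X \<and> int (card a) = z} = {a. a \<subseteq> X \<and> card a = nat z}" by auto
  then show ?thesis using True n_subsets[OF assms, of "nat z"] by (auto simp: bin_def)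
next
  case False
  then have "{a. a \<subseteq> X \<and> int (card a) = z} = {}" by auto
  then show ?thesis using False by (simp add: bin_def)
qed

lemma card_subsets_Un_eq_bin:
  assumes "finite X" "finite Y" "X \<inter> Y = {}"
  shows "real (card {c. c \<subseteq> X \<union> Y \<and> int (card (c \<inter> X)) = p \<and> int (card (c \<inter> Y)) = q})
    = bin (int (card X)) p * bin (int (card Y)) q"
proof -
  let ?A = "{a. a \<subseteq> X \<and> int (card a) = p}" and ?B = "{b. b \<subseteq> Y \<and> int (card b) = q}"
  have "bij_betw (\<lambda>c. (c \<inter> X, c \<inter> Y))
      {c. c \<subseteq> X \<union> Y \<and> int (card (c \<inter> X)) = p \<and> int (card (c \<inter> Y)) = q} (?A \<times> ?B)"
  proof (rule bij_betw_byWitness[where f' = "\<lambda>(a, b). a \<union> b"])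
    have "(a \<union> b) \<inter> X = a" "(a \<union> b) \<inter> Y = b" if "a \<subseteq> X" "b \<subseteq> Y" for a b
      using that assms(3) by blast+
    then show "\<forall>ab\<in>?A \<times> ?B. (\<lambda>c. (c \<inter> X, c \<inter> Y)) ((\<lambda>(a, b). a \<union> b) ab) = ab"
      "(\<lambda>(a, b). a \<union> b) ` (?A \<times> ?B)
        \<subseteq> {c. c \<subseteq> X \<union> Y \<and> int (card (c \<inter> X)) = p \<and> int (card (c \<inter> Y)) = q}"
      by auto
  qed auto
  from bij_betw_same_card[OF this] show ?thesis
    by (simp add: card_cartesian_product card_subsets_eq_bin[OF assms(1)]
        card_subsets_eq_bin[OF assms(2)])
qed

lemma card_superset_parts:
  assumes fin: "finite u" "finite w" "finite Y" and disjoint: "Y \<inter> u = {}" "Y \<inter> w = {}"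
    and c_subset: "c \<subseteq> (u - w) \<union> Y"
  shows "card (w \<union> c) = card w + card (c \<inter> (u - w)) + card (c \<inter> Y)"
    and "card (u \<inter> (w \<union> c)) = card (u \<inter> w) + card (c \<inter> (u - w))"
proof -
  have fin_c: "finite c" using finite_subset[OF c_subset] fin by simp
  have "w \<inter> c = {}" using c_subset disjoint(2) by blast
  then have "card (w \<union> c) = card w + card c" by (rule card_Un_disjoint[OF fin(2) fin_c])
  moreover have "c - (u - w) = c \<inter> Y" using c_subset disjoint(1) by blast
  ultimately show "card (w \<union> c) = card w + card (c \<inter> (u - w)) + card (c \<inter> Y)"
    using card_Int_Diff[OF fin_c, of "u - w"] by simp
  have "u \<inter> (w \<union> c) = (u \<inter> w) \<union> (c \<inter> (u - w))" using c_subset disjoint(1) by blast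
  also have "card \<dots> = card (u \<inter> w) + card (c \<inter> (u - w))"
    using fin fin_c by (intro card_Un_disjoint) auto
  finally show "card (u \<inter> (w \<union> c)) = card (u \<inter> w) + card (c \<inter> (u - w))" .
qed

lemma bij_betw_Diff_supersets:
  assumes finite_S: "finite S" and u_subset: "u \<subseteq> S" and w_subset: "w \<subseteq> S"
  shows "bij_betw (\<lambda>v. v - w) {v. w \<subseteq> v \<and> v \<subseteq> S \<and> card v = j \<and> card (u \<inter> v) = t}
    {c. c \<subseteq> (u - w) \<union> (S - (u \<union> w))
      \<and> int (card (c \<inter> (u - w))) = int t - int (card (u \<inter> w))
      \<and> int (card (c \<inter> (S - (u \<union> w)))) = int j - int (card w) - int t + int (card (u \<inter> w))}"
    (is "bij_betw _ ?V ?C")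
proof (rule bij_betw_byWitness[where f' = "\<lambda>c. w \<union> c"])
  let ?X = "u - w" and ?Y = "S - (u \<union> w)"
  have "finite u" "finite w" using finite_S u_subset w_subset by (auto intro: finite_subset)
  note cards = card_superset_parts[OF this finite_Diff[OF finite_S, of "u \<union> w"]]
  show "(\<lambda>v. v - w) ` ?V \<subseteq> ?C"
  proof (rule image_subsetI)
    fix v assume "v \<in> ?V"
    then have v_props: "w \<subseteq> v" "v \<subseteq> S" "card v = j" "card (u \<inter> v) = t" by blast+
    then have parts: "v - w \<subseteq> ?X \<union> ?Y" "w \<union> (v - w) = v" by blast+
    have "card v = card w + card ((v - w) \<inter> ?X) + card ((v - w) \<inter> ?Y)"
      "card (u \<inter> v) = card (u \<inter> w) + card ((v - w) \<inter> ?X)"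
      using cards[OF _ _ parts(1)] unfolding parts(2) by blast+
    then show "v - w \<in> ?C" using parts(1) v_props(3,4) by simp
  qed
  show "(\<lambda>c. w \<union> c) ` ?C \<subseteq> ?V"
  proof (rule image_subsetI)
    fix c assume "c \<in> ?C"
    then have c_subset: "c \<subseteq> ?X \<union> ?Y"
      and "int (card (c \<inter> ?X)) = int t - int (card (u \<inter> w))"
      and "int (card (c \<inter> ?Y)) = int j - int (card w) - int t + int (card (u \<inter> w))"
      by blast+
    moreover have "card (w \<union> c) = card w + card (c \<inter> ?X) + card (c \<inter> ?Y)"
      "card (u \<inter> (w \<union> c)) = card (u \<inter> w) + card (c \<inter> ?X)"
      using cards[OF _ _ c_subset] by blast+
    ultimately have "card (w \<union> c) = j" "card (u \<inter> (w \<union> c)) = t" by linarith+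
    moreover have "w \<union> c \<subseteq> S" using c_subset u_subset w_subset by blast
    ultimately show "w \<union> c \<in> ?V" by blast
  qed
qed auto

lemma card_supersets_eq_bin:
  assumes finite_S: "finite S" and u_subset: "u \<subseteq> S" and w_subset: "w \<subseteq> S"
  shows "real (card {v. w \<subseteq> v \<and> v \<subseteq> S \<and> card v = j \<and> card (u \<inter> v) = t})
    = bin (int (card u) - int (card (u \<inter> w))) (int t - int (card (u \<inter> w)))
      * bin (int (card S) - int (card u) - int (card w) + int (card (u \<inter> w)))
          (int j - int (card w) - int t + int (card (u \<inter> w)))"
proof -
  let ?X = "u - w" and ?Y = "S - (u \<union> w)"
  have fin: "finite u" "finite w" using finite_S u_subset w_subset by (auto intro: finite_subset)
  have "real (card {v. w \<subseteq> v \<and> v \<subseteq> S \<and> card v = j \<and> card (u \<inter> v) = t})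
      = bin (int (card ?X)) (int t - int (card (u \<inter> w)))
        * bin (int (card ?Y)) (int j - int (card w) - int t + int (card (u \<inter> w)))"
    unfolding bij_betw_same_card[OF bij_betw_Diff_supersets[OF assms]]
    by (rule card_subsets_Un_eq_bin) (use finite_S fin in auto)
  moreover have "int (card ?X) = int (card u) - int (card (u \<inter> w))"
    using card_Int_Diff[OF fin(1), of w] by simp
  moreover have "int (card ?Y) = int (card S) - int (card u) - int (card w) + int (card (u \<inter> w))"
  proof -
    have "card S = card (u \<union> w) + card ?Y"
      using u_subset w_subset card_Int_Diff[OF finite_S, of "u \<union> w"] by (simp add: Int_absorb1)
    then show ?thesis using card_Un_Int[OF fin] by simp
  qed
  ultimately show ?thesis by presburger
qed

lemma sum_Pow_card:
  fixes F :: "nat \<Rightarrow> 'b :: semiring_1"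
  assumes "finite A"
  shows "(\<Sum>L\<in>Pow A. F (card L)) = (\<Sum>l = 0..card A. of_nat (card A choose l) * F l)"
proof -
  have "(\<Sum>L\<in>Pow A. F (card L)) = (\<Sum>l = 0..card A. \<Sum>L | L \<in> Pow A \<and> card L = l. F (card L))"
    by (rule sum.group[symmetric]) (use assms in \<open>auto intro: card_mono\<close>)
  also have "\<dots> = (\<Sum>l = 0..card A. of_nat (card A choose l) * F l)"
    by (intro sum.cong refl) (use n_subsets[OF assms] in simp)
  finally show ?thesis .
qed

lemma prod_of_bool:
  "finite X \<Longrightarrow> (\<Prod>k\<in>X. of_bool (P k)) = (of_bool (\<forall>k\<in>X. P k) :: 'a :: comm_semiring_1)"
  by (induction X rule: finite_induct) auto

definition orbit_term :: "nat \<Rightarrow> nat \<Rightarrow> nat \<Rightarrow> nat \<Rightarrow> nat \<Rightarrow> nat \<Rightarrow> real" where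
  "orbit_term n r i j t l = (- 1) ^ (r - l) * bin (int r) (int l)
     * bin (int i - int l) (int t - int l)
     * bin (int n - int i - int r + int l) (int j - int r - int t + int l)"

definition orbit_coeff :: "nat \<Rightarrow> nat \<Rightarrow> nat \<Rightarrow> nat \<Rightarrow> nat \<Rightarrow> real" where
  "orbit_coeff n r i j t =
     bin (int n - 2 * int r) (int i - int r) * (\<Sum>l = 0..r. orbit_term n r i j t l)"

locale point_pairs =
  fixes S :: "'a set" and R :: "'b set" and e e' :: "'b \<Rightarrow> 'a"
  assumes finite_S: "finite S"
    and inj_e: "inj_on e R" and inj_e': "inj_on e' R" and disjoint: "e ` R \<inter> e' ` R = {}"
    and subset_S: "e ` R \<subseteq> S" "e' ` R \<subseteq> S"
begin

definition pair_sign :: "'a set \<Rightarrow> real" where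
  "pair_sign u = (\<Prod>k\<in>R. of_bool (e k \<in> u) - of_bool (e' k \<in> u))"

definition transversal :: "'a set \<Rightarrow> bool" where
  "transversal u \<longleftrightarrow> (\<forall>k\<in>R. (e k \<in> u) \<noteq> (e' k \<in> u))"

definition choice :: "'b set \<Rightarrow> 'a set" where
  "choice L = e ` L \<union> e' ` (R - L)"

lemma finite_R: "finite R"
  using finite_imageD[OF finite_subset[OF subset_S(1) finite_S] inj_e] .

lemma choice_subset: "L \<subseteq> R \<Longrightarrow> choice L \<subseteq> e ` R \<union> e' ` R" "L \<subseteq> R \<Longrightarrow> choice L \<subseteq> S"
  using subset_S unfolding choice_def by auto

lemma card_choice:
  assumes "L \<subseteq> R"
  shows "card (choice L) = card R"
proof -
  have fin: "finite L" using assms finite_R finite_subset by blast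
  have "card (choice L) = card (e ` L) + card (e' ` (R - L))"
    unfolding choice_def using fin finite_R disjoint assms by (intro card_Un_disjoint) auto
  also have "\<dots> = card L + card (R - L)"
    using card_image[OF inj_on_subset[OF inj_e assms]]
      card_image[OF inj_on_subset[OF inj_e', of "R - L"]]
    by auto
  also have "\<dots> = card R"
    using card_Int_Diff[OF finite_R, of L] assms by (simp add: Int_absorb1)
  finally show ?thesis .
qed

lemma pair_sign_eq_0: "\<not> transversal u \<Longrightarrow> pair_sign u = 0"
  unfolding transversal_def pair_sign_def using finite_R by (force intro: prod_zero)

lemma pair_sign_Diff: "pair_sign (S - u) = (- 1) ^ card R * pair_sign u"
proof -
  have "pair_sign (S - u) = (\<Prod>k\<in>R. - 1 * (of_bool (e k \<in> u) - of_bool (e' k \<in> u)))"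
    unfolding pair_sign_def using subset_S by (intro prod.cong) auto
  also have "\<dots> = (- 1) ^ card R * pair_sign u"
    unfolding pair_sign_def prod.distrib by simp
  finally show ?thesis .
qed

lemma pair_sign_expand:
  "pair_sign v = (\<Sum>L\<in>Pow R. (- 1) ^ (card R - card L) * of_bool (choice L \<subseteq> v))"
proof -
  have "pair_sign v = (\<Sum>L\<in>Pow R. (- 1) ^ (card R - card L)
      * (\<Prod>k\<in>L. of_bool (e k \<in> v)) * (\<Prod>k\<in>R - L. of_bool (e' k \<in> v)))"
    unfolding pair_sign_def by (rule prod_diff_conv_sum'[OF finite_R])
  also have "\<dots> = (\<Sum>L\<in>Pow R. (- 1) ^ (card R - card L) * of_bool (choice L \<subseteq> v))"
  proof (intro sum.cong refl)
    fix L assume "L \<in> Pow R"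
    then have "finite L" "finite (R - L)" using finite_R finite_subset by auto
    then show "(- 1) ^ (card R - card L) * (\<Prod>k\<in>L. of_bool (e k \<in> v))
          * (\<Prod>k\<in>R - L. of_bool (e' k \<in> v))
        = ((- 1) ^ (card R - card L) * of_bool (choice L \<subseteq> v) :: real)"
      by (auto simp: prod_of_bool choice_def)
  qed
  finally show ?thesis .
qed

lemma sum_pair_sign:
  assumes separates: "u \<subseteq> S" "e ` R \<subseteq> u" "e' ` R \<inter> u = {}"
  shows "(\<Sum>v | v \<subseteq> S \<and> card v = j \<and> card (u \<inter> v) = t. pair_sign v)
    = (\<Sum>l = 0..card R. orbit_term (card S) (card R) (card u) j t l)"
proof -
  let ?V = "{v. v \<subseteq> S \<and> card v = j \<and> card (u \<inter> v) = t}"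
  let ?F = "\<lambda>l. (- 1) ^ (card R - l) * (bin (int (card u) - int l) (int t - int l)
    * bin (int (card S) - int (card u) - int (card R) + int l)
        (int j - int (card R) - int t + int l))"
  have fin: "finite ?V" using finite_S by simp
  have inter: "card (u \<inter> choice L) = card L" if "L \<subseteq> R" for L
  proof -
    have "u \<inter> choice L = e ` L" using that separates unfolding choice_def by blast
    then show ?thesis using card_image[OF inj_on_subset[OF inj_e that]] by simp
  qed
  have "(\<Sum>v\<in>?V. pair_sign v)
      = (\<Sum>L\<in>Pow R. \<Sum>v\<in>?V. (- 1) ^ (card R - card L) * of_bool (choice L \<subseteq> v))"
    unfolding pair_sign_expand by (rule sum.swap)
  also have "\<dots> = (\<Sum>L\<in>Pow R. ?F (card L))"
  proof (intro sum.cong refl)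
    fix L assume "L \<in> Pow R"
    then have L_subset: "L \<subseteq> R" by simp
    have "(\<Sum>v\<in>?V. (- 1) ^ (card R - card L) * of_bool (choice L \<subseteq> v)) = (- 1) ^ (card R - card L)
        * real (card {v. choice L \<subseteq> v \<and> v \<subseteq> S \<and> card v = j \<and> card (u \<inter> v) = t})"
      using fin by (simp add: Int_def conj_ac flip: sum_distrib_left del: sum_mult_of_bool_eq)
    then show "(\<Sum>v\<in>?V. (- 1) ^ (card R - card L) * of_bool (choice L \<subseteq> v)) = ?F (card L)"
      unfolding card_supersets_eq_bin[OF finite_S separates(1) choice_subset(2)[OF L_subset]]
        card_choice[OF L_subset] inter[OF L_subset] .
  qed
  also have "\<dots> = (\<Sum>l = 0..card R. real (card R choose l) * ?F l)"
    by (rule sum_Pow_card[OF finite_R])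
  also have "\<dots> = (\<Sum>l = 0..card R. orbit_term (card S) (card R) (card u) j t l)"
    by (intro sum.cong refl) (simp add: orbit_term_def bin_def[of "int (card R)"] mult_ac)
  finally show ?thesis .
qed

text \<open>
  Multiplying by \<open>pair_sign u\<close> amounts to exchanging the two points of each pair whose second point
  lies in \<open>u\<close>.
\<close>

lemma sum_pair_sign_mult:
  assumes u_transversal: "u \<subseteq> S" "transversal u"
  shows "(\<Sum>v | v \<subseteq> S \<and> card v = j \<and> card (u \<inter> v) = t. pair_sign u * pair_sign v)
    = (\<Sum>l = 0..card R. orbit_term (card S) (card R) (card u) j t l)"
proof -
  define f where "f k = (if e k \<in> u then e k else e' k)" for k
  define f' where "f' k = (if e k \<in> u then e' k else e k)" for k
  have f_u: "f k \<in> u" "f' k \<notin> u" if "k \<in> R" for k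
    using u_transversal(2) that by (auto simp: transversal_def f_def f'_def)
  interpret flipped: point_pairs S R f f'
  proof
    have distinct: "e k \<noteq> e' l" "e' l \<noteq> e k" if "k \<in> R" "l \<in> R" for k l
      using disjoint that by blast+
    show "inj_on f R" "inj_on f' R"
      by (rule inj_onI;
          simp add: f_def f'_def distinct inj_on_eq_iff[OF inj_e] inj_on_eq_iff[OF inj_e']
          split: if_splits)+
    show "f ` R \<inter> f' ` R = {}" using f_u by force
    show "f ` R \<subseteq> S" "f' ` R \<subseteq> S" using subset_S by (auto simp: f_def f'_def)
  qed (rule finite_S)
  have "pair_sign u * pair_sign v = flipped.pair_sign v" for v
    unfolding pair_sign_def flipped.pair_sign_def prod.distrib[symmetric]
    using u_transversal(2) by (intro prod.cong) (auto simp: transversal_def f_def f'_def)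
  moreover have "f ` R \<subseteq> u" "f' ` R \<inter> u = {}" using f_u by blast+
  ultimately show ?thesis using flipped.sum_pair_sign[OF u_transversal(1)] by simp
qed

lemma in_choice_iff:
  assumes "L \<subseteq> R" "k \<in> R"
  shows "e k \<in> choice L \<longleftrightarrow> k \<in> L" "e' k \<in> choice L \<longleftrightarrow> k \<notin> L"
proof -
  have "e k \<notin> e' ` (R - L)" "e' k \<notin> e ` L" using assms disjoint by blast+
  then show "e k \<in> choice L \<longleftrightarrow> k \<in> L" "e' k \<in> choice L \<longleftrightarrow> k \<notin> L"
    using assms inj_on_image_mem_iff[OF inj_e] inj_on_image_mem_iff[OF inj_e', of k "R - L"]
    by (auto simp: choice_def)
qed

lemma transversal_iff_choice:
  assumes L_subset: "L \<subseteq> R"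
  shows "transversal u \<and> {k \<in> R. e k \<in> u} = L
    \<longleftrightarrow> choice L \<subseteq> u \<and> card ((e ` R \<union> e' ` R) \<inter> u) = card R"
proof -
  let ?P = "e ` R \<union> e' ` R"
  have "finite ?P" using finite_R by simp
  have "transversal u \<and> {k \<in> R. e k \<in> u} = L
      \<longleftrightarrow> (\<forall>k\<in>R. (e k \<in> u \<longleftrightarrow> e k \<in> choice L) \<and> (e' k \<in> u \<longleftrightarrow> e' k \<in> choice L))"
    using L_subset by (auto simp: transversal_def in_choice_iff[OF L_subset])
  also have "\<dots> \<longleftrightarrow> (\<forall>x\<in>?P. x \<in> u \<longleftrightarrow> x \<in> choice L)" by blast
  also have "\<dots> \<longleftrightarrow> ?P \<inter> u = choice L" using choice_subset(1)[OF L_subset] by blast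
  also have "\<dots> \<longleftrightarrow> choice L \<subseteq> u \<and> card (?P \<inter> u) = card R"
  proof
    assume "choice L \<subseteq> u \<and> card (?P \<inter> u) = card R"
    then have "choice L = ?P \<inter> u"
      using \<open>finite ?P\<close> choice_subset(1)[OF L_subset] card_choice[OF L_subset]
      by (intro card_subset_eq) auto
    then show "?P \<inter> u = choice L" ..
  next
    assume "?P \<inter> u = choice L"
    then show "choice L \<subseteq> u \<and> card (?P \<inter> u) = card R" 
      using card_choice[OF L_subset] by (metis Int_lower2)
  qed
  finally show ?thesis .
qed

lemma card_transversals:
  "real (card {u. u \<subseteq> S \<and> card u = i \<and> transversal u})
    = 2 ^ card R * bin (int (card S) - 2 * int (card R)) (int i - int (card R))"
proof -
  let ?T = "{u. u \<subseteq> S \<and> card u = i \<and> transversal u}" and ?P = "e ` R \<union> e' ` R"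
  let ?L = "\<lambda>u. {k \<in> R. e k \<in> u}"
  let ?b = "bin (int (card S) - 2 * int (card R)) (int i - int (card R))"
  have pairs: "card ?P = 2 * card R" "?P \<subseteq> S"
    using subset_S finite_R disjoint card_image[OF inj_e] card_image[OF inj_e']
    by (simp_all add: card_Un_disjoint)
  have fiber: "(\<Sum>u | u \<in> ?T \<and> ?L u = L. 1) = ?b" if L_subset: "L \<subseteq> R" for L
  proof -
    have "{u. u \<in> ?T \<and> ?L u = L} = {u. choice L \<subseteq> u \<and> u \<subseteq> S \<and> card u = i \<and> card (?P \<inter> u) = card R}"
      using transversal_iff_choice[OF L_subset] by blast
    then have "(\<Sum>u | u \<in> ?T \<and> ?L u = L. 1)
        = real (card {u. choice L \<subseteq> u \<and> u \<subseteq> S \<and> card u = i \<and> card (?P \<inter> u) = card R})"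
      by (simp only: real_of_card)
    moreover have "?P \<inter> choice L = choice L" using choice_subset(1)[OF L_subset] by blast
    ultimately show ?thesis
      unfolding card_supersets_eq_bin[OF finite_S pairs(2) choice_subset(2)[OF L_subset]]
      by (simp add: card_choice[OF L_subset] pairs(1) bin_def[of _ 0])
  qed
  have "real (card ?T) = (\<Sum>L\<in>Pow R. \<Sum>u | u \<in> ?T \<and> ?L u = L. 1)"
    unfolding real_of_card by (rule sum.group[symmetric]) (use finite_S finite_R in auto)
  also have "\<dots> = (\<Sum>L\<in>Pow R. ?b)"
    by (intro sum.cong refl fiber) simp
  finally show ?thesis by (simp add: card_Pow finite_R)
qed

lemma pair_orbit_sum:
  "(\<Sum>(u, v)\<in>pair_orbit S i j t. pair_sign u * pair_sign v)
    = 2 ^ card R * orbit_coeff (card S) (card R) i j t"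
proof -
  let ?V = "\<lambda>u. {v. v \<subseteq> S \<and> card v = j \<and> card (u \<inter> v) = t}"
  let ?U = "{u. u \<subseteq> S \<and> card u = i}" and ?T = "{u. u \<subseteq> S \<and> card u = i \<and> transversal u}"
  have "pair_orbit S i j t = Sigma ?U ?V" by (auto simp: pair_orbit_def)
  then have "(\<Sum>(u, v)\<in>pair_orbit S i j t. pair_sign u * pair_sign v)
      = (\<Sum>u\<in>?U. \<Sum>v\<in>?V u. pair_sign u * pair_sign v)"
    using finite_S by (simp add: sum.Sigma)
  also have "\<dots> = (\<Sum>u\<in>?T. \<Sum>v\<in>?V u. pair_sign u * pair_sign v)"
    by (rule sum.mono_neutral_right) (use finite_S in \<open>auto simp: pair_sign_eq_0\<close>)
  also have "\<dots> = (\<Sum>u\<in>?T. \<Sum>l = 0..card R. orbit_term (card S) (card R) i j t l)"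
    by (intro sum.cong refl) (use sum_pair_sign_mult in auto)
  also have "\<dots> = 2 ^ card R * orbit_coeff (card S) (card R) i j t"
    using card_transversals[of i] by (simp add: orbit_coeff_def)
  finally show ?thesis .
qed

lemma sum_pair_sign_kernel:
  assumes kernel_eq: "\<And>i j t u v. (u, v) \<in> pair_orbit S i j t \<Longrightarrow> K u v = y i j t"
  shows "(\<Sum>u\<in>Pow S. \<Sum>v\<in>Pow S.
      (of_bool (card u = i) * pair_sign u) * K u v * (of_bool (card v = j) * pair_sign v))
    = 2 ^ card R * (\<Sum>t = 0..min i j. orbit_coeff (card S) (card R) i j t * y i j t)"
proof -
  let ?U = "\<lambda>i. {u. u \<subseteq> S \<and> card u = i}"
  let ?h = "\<lambda>(u, v). pair_sign u * K u v * pair_sign v"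
  have fin: "finite (Pow S)" "finite (?U i \<times> ?U j)" using finite_S by simp_all
  have "(\<Sum>u\<in>Pow S. \<Sum>v\<in>Pow S.
      (of_bool (card u = i) * pair_sign u) * K u v * (of_bool (card v = j) * pair_sign v))
      = (\<Sum>x\<in>Pow S \<times> Pow S. if x \<in> ?U i \<times> ?U j then ?h x else 0)"
    unfolding sum.cartesian_product by (intro sum.cong) auto
  also have "\<dots> = (\<Sum>x\<in>?U i \<times> ?U j. ?h x)"
    using fin by (simp add: sum.If_cases Int_def) (auto intro: sum.cong)
  also have "\<dots> = (\<Sum>t = 0..min i j. \<Sum>x | x \<in> ?U i \<times> ?U j \<and> card (fst x \<inter> snd x) = t. ?h x)"
  proof (rule sum.group[symmetric])
    show "(\<lambda>x. card (fst x \<inter> snd x)) ` (?U i \<times> ?U j) \<subseteq> {0..min i j}"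
      using pair_orbit_bounds[OF finite_S] by (fastforce simp: pair_orbit_def)
  qed (use fin in simp_all)
  also have "\<dots> = (\<Sum>t = 0..min i j.
      \<Sum>(u, v)\<in>pair_orbit S i j t. y i j t * (pair_sign u * pair_sign v))"
    by (intro sum.cong refl) (auto simp: pair_orbit_def intro!: sum.cong kernel_eq)
  also have "\<dots> = (\<Sum>t = 0..min i j.
      y i j t * (\<Sum>(u, v)\<in>pair_orbit S i j t. pair_sign u * pair_sign v))"
    by (simp only: sum_distrib_left case_prod_unfold)
  also have "\<dots> = 2 ^ card R * (\<Sum>t = 0..min i j. orbit_coeff (card S) (card R) i j t * y i j t)"
    unfolding pair_orbit_sum by (simp add: sum_distrib_left mult_ac)
  finally show ?thesis .
qed

end

lemma point_pairs_interval:
  fixes n r :: nat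
  assumes "2 * r \<le> n"
  shows "point_pairs {1..n} {1..r} id (\<lambda>k. k + r)"
  using assms by unfold_locales auto

lemma orbit_coeff_commute:
  assumes "2 * r \<le> n"
  shows "orbit_coeff n r i j t = orbit_coeff n r j i t"
proof -
  interpret point_pairs "{1..n}" "{1..r}" id "\<lambda>k. k + r" by (rule point_pairs_interval[OF assms])
  have "(\<Sum>(u, v)\<in>pair_orbit {1..n} i j t. pair_sign u * pair_sign v)
      = (\<Sum>(u, v)\<in>pair_orbit {1..n} j i t. pair_sign u * pair_sign v)"
    by (rule sum.reindex_bij_witness[where i = prod.swap and j = prod.swap])
      (auto simp: pair_orbit_swap mult.commute)
  then show ?thesis unfolding pair_orbit_sum by simp
qed

lemma orbit_coeff_reflect:
  assumes "2 * r \<le> n" "i \<le> n" "t \<le> j"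
  shows "orbit_coeff n r (n - i) j (j - t) = (- 1) ^ r * orbit_coeff n r i j t"
proof -
  interpret point_pairs "{1..n}" "{1..r}" id "\<lambda>k. k + r" by (rule point_pairs_interval[OF assms(1)])
  let ?c = "\<lambda>(u, v). ({1..n} - u, v)"
  have reflect: "?c x \<in> pair_orbit {1..n} (n - i) j (j - t)" "?c (?c x) = x"
    if "x \<in> pair_orbit {1..n} i j t" for x i t
  proof -
    obtain u v where x_eq: "x = (u, v)" by (cases x)
    then have "(u, v) \<in> pair_orbit {1..n} i j t" using that by simp
    from pair_orbit_Diff[OF _ this] show "?c x \<in> pair_orbit {1..n} (n - i) j (j - t)"
      using x_eq by simp
    show "?c (?c x) = x" using that x_eq by (simp add: pair_orbit_def double_diff)
  qed
  have sign: "(- 1) ^ r * pair_sign ({1..n} - u) = pair_sign u" for u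
    unfolding pair_sign_Diff by (simp flip: power_add mult_2 mult.assoc)
  have "(\<Sum>(u, v)\<in>pair_orbit {1..n} (n - i) j (j - t). pair_sign u * pair_sign v)
      = (\<Sum>(u, v)\<in>pair_orbit {1..n} i j t. (- 1) ^ r * (pair_sign u * pair_sign v))"
  proof (rule sum.reindex_bij_witness[where i = ?c and j = ?c])
    fix x assume x_orbit: "x \<in> pair_orbit {1..n} (n - i) j (j - t)"
    show "?c (?c x) = x" by (rule reflect(2)[OF x_orbit])
    show "?c x \<in> pair_orbit {1..n} i j t" using reflect(1)[OF x_orbit] assms(2,3) by simp
    show "(case ?c x of (u, v) \<Rightarrow> (- 1) ^ r * (pair_sign u * pair_sign v))
        = (case x of (u, v) \<Rightarrow> pair_sign u * pair_sign v)"
      by (simp only: case_prod_unfold fst_conv snd_conv mult.assoc[symmetric] sign)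
  qed (fact reflect)+
  also have "\<dots> = (- 1) ^ r * (\<Sum>(u, v)\<in>pair_orbit {1..n} i j t. pair_sign u * pair_sign v)"
    by (simp only: sum_distrib_left case_prod_unfold)
  finally show ?thesis unfolding pair_orbit_sum by simp
qed

section \<open>The coefficients of the program\<close>

lemma sum_split_half:
  fixes F :: "nat \<Rightarrow> 'a :: comm_monoid_add"
  shows "(\<Sum>l = 0..n. F l)
    = (\<Sum>l = n div 2 + 1..n. F l + F (n - l)) + (if even n then F (n div 2) else 0)"
proof -
  let ?A = "{0..<(n + 1) div 2}" and ?M = "if even n then {n div 2} else {}"
    and ?B = "{n div 2 + 1..n}"
  have "{0..n} = ?A \<union> ?M \<union> ?B" by (auto elim!: evenE oddE)
  moreover have "sum F (?A \<union> ?M \<union> ?B) = sum F ?A + sum F ?M + sum F ?B"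
    by (subst sum.union_disjoint; (subst sum.union_disjoint)?) (auto elim!: oddE)
  moreover have "sum F ?A = (\<Sum>l\<in>?B. F (n - l))"
    by (rule sum.reindex_bij_witness[where i = "\<lambda>l. n - l" and j = "\<lambda>l. n - l"]) auto
  ultimately show ?thesis by (simp add: sum.distrib ac_simps)
qed

lemma sum_fold_half:
  fixes F :: "nat \<Rightarrow> 'a :: comm_semiring_1"
  assumes "\<And>t. t \<le> n \<Longrightarrow> F (n - t) = F t"
  shows "(\<Sum>t = (n + 1) div 2..n. (if 2 * t = n then 1 else 2) * F t) = (\<Sum>t = 0..n. F t)"
proof -
  let ?w = "\<lambda>t. (if 2 * t = n then 1 else 2) * F t"
  have "(\<Sum>t = (n + 1) div 2..n. ?w t)
      = (\<Sum>t = n div 2 + 1..n. ?w t) + (if even n then F (n div 2) else 0)"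
  proof (cases "even n")
    case True
    then have "{(n + 1) div 2..n} = insert (n div 2) {n div 2 + 1..n}" by auto
    then show ?thesis using True by (simp add: add.commute)
  next
    case False
    then have "(n + 1) div 2 = n div 2 + 1" by (auto elim: oddE)
    then show ?thesis using False by simp
  qed
  also have "(\<Sum>t = n div 2 + 1..n. ?w t) = (\<Sum>t = n div 2 + 1..n. F t + F (n - t))"
    by (intro sum.cong) (auto simp: assms mult_2)
  finally show ?thesis using sum_split_half[of F n] by simp
qed

lemma minus_one_power_diff: "even r \<Longrightarrow> l \<le> r \<Longrightarrow> (- 1 :: 'a :: ring_1) ^ (r - l) = (- 1) ^ l"
  by (simp add: minus_one_power_iff)

lemma beta_generic_less_less:
  assumes "r \<le> i" "i < D" "j < D"
  shows "beta_generic D r i j t = orbit_coeff (2 * D) r i j t"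
proof -
  have "(\<Sum>l = 0..D - 1. orbit_term (2 * D) r i j t l) = (\<Sum>l = 0..r. orbit_term (2 * D) r i j t l)"
    using assms by (intro sum.mono_neutral_right) (auto simp: orbit_term_def bin_eq_0)
  then show ?thesis using assms by (simp add: beta_generic_def orbit_coeff_def orbit_term_def)
qed

lemma beta_generic_eq_less:
  assumes even_le: "even r" "r \<le> j" and j_less: "j < D"
  shows "beta_generic D r D j t = 2 * orbit_coeff (2 * D) r D j t"
proof -
  let ?T = "orbit_term (2 * D) r D j t"
  let ?G = "\<lambda>l. (- 1) ^ (r - l) * bin (int r) (int l) *
           (bin (int D - int l) (int t - int l)
              * bin (int D - int r + int l) (int j - int t - int r + int l)
            + bin (int D - int r + int l) (int t - int r + int l)
              * bin (int D - int l) (int j - int t - int l))"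
  have pair: "?G l = ?T l + ?T (r - l)" if "l \<le> r" for l
    using that minus_one_power_diff[OF even_le(1) that, where 'a = real]
      bin_int_symmetric[OF that]
    by (simp add: orbit_term_def of_nat_diff algebra_simps)
  have middle: "?T (r div 2) = bin (int D - int (r div 2)) (int t - int (r div 2))
          * bin (int D - int (r div 2)) (int j - int t - int (r div 2))
          * (- 1) ^ (r div 2) * bin (int r) (int (r div 2))"
    using even_le(1) by (auto elim!: evenE simp: orbit_term_def algebra_simps)
  have "(\<Sum>l = r div 2 + 1..D - 1. ?G l) = (\<Sum>l = r div 2 + 1..r. ?G l)"
    using even_le j_less by (intro sum.mono_neutral_right) (auto simp: bin_eq_0)
  also have "\<dots> = (\<Sum>l = r div 2 + 1..r. ?T l + ?T (r - l))"
    by (intro sum.cong refl pair) simp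
  finally have "(\<Sum>l = r div 2 + 1..D - 1. ?G l) + ?T (r div 2) = (\<Sum>l = 0..r. ?T l)"
    using sum_split_half[of ?T r] even_le(1) by simp
  then show ?thesis
    using j_less unfolding beta_generic_def orbit_coeff_def middle by simp
qed

lemma beta_generic_less_eq:
  assumes r_le: "r \<le> i" and i_less: "i < D" and t_le: "t \<le> i"
  shows "beta_generic D r i D t = orbit_coeff (2 * D) r i D t + orbit_coeff (2 * D) r i D (i - t)"
proof -
  let ?T = "orbit_term (2 * D) r i D"
  let ?G = "\<lambda>l. (- 1) ^ (r - l) * bin (int r) (int l) *
          (bin (int i - int l) (int t - int l)
             * bin (2 * int D - int r - int i + int l) (int D - int r - int t + int l)
           + bin (int i - int l) (int t)
             * bin (2 * int D - int r - int i + int l) (int D - int t))"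
  have "bin (int i - int l) (int t) = bin (int i - int l) (int (i - t) - int l)"
    "bin (2 * int D - int r - int i + int l) (int D - int t)
      = bin (2 * int D - int i - int r + int l) (int D - int r - int (i - t) + int l)" for l
    using t_le bin_symmetric[of "int i - int l" "int t"]
      bin_symmetric[of "2 * int D - int r - int i + int l" "int D - int t"]
    by (simp_all add: of_nat_diff algebra_simps)
  then have pair: "?G l = ?T t l + ?T (i - t) l" for l
    by (simp add: orbit_term_def algebra_simps)
  have "(\<Sum>l = 0..D - 1. ?G l) = (\<Sum>l = 0..r. ?G l)"
    using r_le i_less by (intro sum.mono_neutral_right) (auto simp: bin_eq_0)
  also have "\<dots> = (\<Sum>l = 0..r. ?T t l) + (\<Sum>l = 0..r. ?T (i - t) l)"
    unfolding pair sum.distrib ..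
  finally show ?thesis
    using i_less unfolding beta_generic_def orbit_coeff_def by (simp add: distrib_left)
qed

lemma beta_generic_eq_eq:
  assumes even_less: "even r" "r < D"
  shows "beta_generic D r D D t = 4 * orbit_coeff (2 * D) r D D t"
proof -
  let ?T = "orbit_term (2 * D) r D D t"
  let ?G = "\<lambda>l. 2 * (- 1) ^ (r - l) * bin (int r) (int l) *
           (bin (int D - int l) (int t - int l) * bin (int D - int r + int l) (int t)
            + bin (int D - int l) (int t) * bin (int D - int r + int l) (int D - int t))"
  have flip: "bin (int D - int r + int l) (int t)
      = bin (int D - int r + int l) (int D - int r - int t + int l)"
    "bin (int D - int l) (int t) = bin (int D - int l) (int D - int t - int l)"
    "bin (int D - int r + int l) (int D - int t)
      = bin (int D - int r + int l) (int t - int r + int l)" for l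
    using bin_symmetric[of "int D - int r + int l" "int t"]
      bin_symmetric[of "int D - int l" "int t"]
      bin_symmetric[of "int D - int r + int l" "int D - int t"]
    by (simp_all add: algebra_simps)
  have pair: "?G l = 2 * (?T l + ?T (r - l))" if "l \<le> r" for l
    using that minus_one_power_diff[OF even_less(1) that, where 'a = real]
      bin_int_symmetric[OF that]
    unfolding orbit_term_def flip by (simp add: of_nat_diff algebra_simps)
  have middle: "2 * ?T (r div 2) = 2 * (- 1) ^ (r div 2) * bin (int r) (int (r div 2))
          * bin (int D - int (r div 2)) (int D - int t) * bin (int D - int (r div 2)) (int t)"
  proof -
    obtain m where r_eq: "r = 2 * m" using even_less(1) by blast
    show ?thesis using flip(1)[of m] flip(3)[of m] unfolding orbit_term_def r_eq
      by (simp add: algebra_simps)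
  qed
  have "(\<Sum>l = r div 2 + 1..D - 1. ?G l) = (\<Sum>l = r div 2 + 1..r. ?G l)"
    using even_less by (intro sum.mono_neutral_right) (auto simp: bin_eq_0)
  also have "\<dots> = (\<Sum>l = r div 2 + 1..r. 2 * (?T l + ?T (r - l)))"
    by (intro sum.cong refl pair) simp
  also have "\<dots> = 2 * (\<Sum>l = r div 2 + 1..r. ?T l + ?T (r - l))"
    by (simp only: sum_distrib_left)
  finally have "(\<Sum>l = r div 2 + 1..D - 1. ?G l) + 2 * ?T (r div 2) = 2 * (\<Sum>l = 0..r. ?T l)"
    using sum_split_half[of ?T r] even_less(1) by simp
  then show ?thesis
    using even_less unfolding beta_generic_def orbit_coeff_def middle by simp
qed

lemma beta_generic_eq_eq_eq:
  assumes t_bounds: "D div 2 \<le> t" "t \<le> D"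
  shows "beta_generic D D D D t = orbit_coeff (2 * D) D D D t"
proof -
  have "orbit_coeff (2 * D) D D D t = (\<Sum>l = 0..D. orbit_term (2 * D) D D D t l)"
    by (simp add: orbit_coeff_def bin_def)
  also have "\<dots> = (\<Sum>l\<in>{t}. orbit_term (2 * D) D D D t l)"
    using t_bounds by (intro sum.mono_neutral_right) (auto simp: orbit_term_def bin_def)
  also have "\<dots> = (- 1) ^ (D - t) * bin (int D) (int t)"
    using t_bounds by (simp add: orbit_term_def bin_def)
  finally show ?thesis using t_bounds by (simp add: beta_generic_def)
qed

lemma orbit_coeff_reflect_half:
  assumes "even r" "r \<le> D" "i = D \<or> j = D" "i \<le> D" "j \<le> D" "t \<le> min i j"
  shows "orbit_coeff (2 * D) r i j (min i j - t) = orbit_coeff (2 * D) r i j t"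
proof -
  have left: "orbit_coeff (2 * D) r D k (k - t) = orbit_coeff (2 * D) r D k t" if "t \<le> k" for k
    using orbit_coeff_reflect[of r "2 * D" D t k] that assms(1,2) by simp
  have "orbit_coeff (2 * D) r k D s = orbit_coeff (2 * D) r D k s" for k s
    using assms(2) by (intro orbit_coeff_commute) simp
  then have right: "orbit_coeff (2 * D) r k D (k - t) = orbit_coeff (2 * D) r k D t"
    if "t \<le> k" for k
    using left[OF that] by simp
  show ?thesis using assms(3-6) left[of j] right[of i] by (auto simp: min_def)
qed

text \<open>The discrepancy between the formulas for \<open>\<beta>\<close> and a Gram matrix.\<close>

definition block_factor :: "nat \<Rightarrow> nat \<Rightarrow> nat \<Rightarrow> nat \<Rightarrow> real" where
  "block_factor D r i j = (if i = D \<and> j = D then if r < D then 2 else 1 / 2 else 1)"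

lemma beta_eq_orbit_coeff_interior:
  assumes "r \<le> i" "i < D" "j < D"
  shows "beta D r i j t = orbit_coeff (2 * D) r i j t"
  using assms by (simp add: beta_def beta_generic_less_less)

lemma beta_eq_orbit_coeff_boundary:
  assumes boundary: "i = D \<or> j = D" "i \<le> D" "j \<le> D" and even_le: "even r" "r \<le> i" "r \<le> j"
    and t_bounds: "t \<le> min i j" "min i j \<le> 2 * t"
  shows "beta D r i j t
    = block_factor D r i j * ((if 2 * t = min i j then 1 else 2) * orbit_coeff (2 * D) r i j t)"
proof -
  consider "i = D" "j < D" | "i < D" "j = D" | "i = D" "j = D" "r < D" | "i = D" "j = D" "r = D"
    using boundary even_le(2) by linarith
  then show ?thesis
  proof cases
    case 1
    then show ?thesis
      using even_le by (simp add: beta_def block_factor_def beta_generic_eq_less min_def)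
  next
    case 2
    then have "orbit_coeff (2 * D) r i j (i - t) = orbit_coeff (2 * D) r i j t"
      using orbit_coeff_reflect_half[OF even_le(1) _ boundary, of t] even_le t_bounds
      by (simp add: min_def)
    then show ?thesis
      using 2 even_le t_bounds by (simp add: beta_def block_factor_def beta_generic_less_eq min_def)
  next
    case 3
    then show ?thesis using even_le by (simp add: beta_def block_factor_def beta_generic_eq_eq)
  next
    case 4
    then show ?thesis using t_bounds by (simp add: beta_def block_factor_def beta_generic_eq_eq_eq)
  qed
qed

lemma index_set_iff:
  assumes "2 \<le> D" "even D" "i \<le> D" "j \<le> D"
  shows "(i, j, t) \<in> index_set D
    \<longleftrightarrow> t \<le> min i j \<and> (i = D \<longrightarrow> j \<le> 2 * t) \<and> (j = D \<longrightarrow> i \<le> 2 * t)"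
proof -
  have half: "(k + 1) div 2 \<le> t \<longleftrightarrow> k \<le> 2 * t" for k by linarith
  have "i + j - t \<le> 2 * D - 2 \<or> (i, j, t) = (D, D, D div 2)"
    if t_bounds: "t \<le> i" "t \<le> j" "i = D \<longrightarrow> j \<le> 2 * t" "j = D \<longrightarrow> i \<le> 2 * t"
  proof -
    consider "i < D" "j < D" | "i = D" "j < D" | "i < D" "j = D" | "i = D" "j = D"
      using le_neq_implies_less assms(3,4) by blast
    then show ?thesis
    proof cases
      case 2
      then show ?thesis using t_bounds(3) assms(1) by linarith
    next
      case 3
      then show ?thesis using t_bounds(4) assms(1) by linarith
    next
      case 4
      then show ?thesis using t_bounds(3) assms(1,2) by (cases "t = D div 2") auto
    qed linarith
  qed
  moreover have "(i, j, t) \<in> index_set D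
      \<longleftrightarrow> (t \<le> i \<and> t \<le> j \<and> (i = D \<longrightarrow> j \<le> 2 * t) \<and> (j = D \<longrightarrow> i \<le> 2 * t) \<and> i + j - t \<le> 2 * D - 2)
        \<or> (i, j, t) = (D, D, D div 2)"
    using assms(3,4)
    unfolding index_set_def Un_iff mem_Collect_eq case_prod_conv half singleton_iff by blast
  moreover have "D div 2 \<le> D" "D \<le> 2 * (D div 2)" using assms(2) by simp_all
  ultimately show ?thesis unfolding min.bounded_iff by blast
qed

lemma index_set_slice:
  assumes "2 \<le> D" "even D" "i \<le> D" "j \<le> D"
  shows "{t. (i, j, t) \<in> index_set D}
    = {(if i = D \<or> j = D then (min i j + 1) div 2 else 0)..min i j}"
proof (rule set_eqI)
  fix t :: nat
  have half: "(k + 1) div 2 \<le> t \<longleftrightarrow> k \<le> 2 * t" for k by linarith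
  have "(i, j, t) \<in> index_set D \<longleftrightarrow> t \<le> min i j \<and> (i = D \<or> j = D \<longrightarrow> min i j \<le> 2 * t)"
    unfolding index_set_iff[OF assms]
    using assms(3,4) by (cases "i = D"; cases "j = D") (simp_all add: min_absorb1 min_absorb2)
  also have "\<dots> \<longleftrightarrow> t \<in> {(if i = D \<or> j = D then (min i j + 1) div 2 else 0)..min i j}"
    by (cases "i = D \<or> j = D")
      (simp_all only: atLeastAtMost_iff half if_True if_False zero_le simp_thms conj_commute)
  finally show "t \<in> {t. (i, j, t) \<in> index_set D}
      \<longleftrightarrow> t \<in> {(if i = D \<or> j = D then (min i j + 1) div 2 else 0)..min i j}"
    by simp
qed

lemma index_setD:
  assumes "(i, j, t) \<in> index_set D"
  shows "t \<le> i" "t \<le> j" "i \<le> D" "j \<le> D" "i + j - t \<le> 2 * D"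
  using assms unfolding index_set_def by auto

section \<open>The blocks of the program\<close>

definition sdp_block :: "nat \<Rightarrow> nat \<Rightarrow> (nat \<Rightarrow> nat \<Rightarrow> nat \<Rightarrow> real) \<Rightarrow> nat \<Rightarrow> nat \<Rightarrow> real" where
  "sdp_block D r y i j = (\<Sum>t | (i, j, t) \<in> index_set D. beta D r i j t * y i j t)"

lemma block1_eq_sdp_block: "block1 D x r = sdp_block D r x"
  unfolding block1_def sdp_block_def by blast

lemma block2_eq_sdp_block:
  "block2 D x r = sdp_block D r (\<lambda>i j t. x (zeta D i j t) 0 0 - x i j t)"
  unfolding block2_def sdp_block_def by blast

locale antipodal_kernel =
  fixes D :: nat and K :: "nat set \<Rightarrow> nat set \<Rightarrow> real" and y :: "nat \<Rightarrow> nat \<Rightarrow> nat \<Rightarrow> real"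
  assumes dimension: "2 \<le> D" "even D"
    and psd: "psd_kernel (Pow {1..2 * D}) K"
    and orbit: "\<And>i j t u v. (u, v) \<in> pair_orbit {1..2 * D} i j t \<Longrightarrow> K u v = y i j t"
    and complement: "\<And>u v. u \<subseteq> {1..2 * D} \<Longrightarrow> v \<subseteq> {1..2 * D} \<Longrightarrow> K ({1..2 * D} - u) v = K u v"
begin

lemma orbit_value_reflect:
  assumes "i = D \<or> j = D" "i \<le> D" "j \<le> D" "t \<le> min i j"
  shows "y i j (min i j - t) = y i j t"
proof -
  have reflect: "y D k (k - t) = y D k t" "y k D (k - t) = y k D t"
    if k_bounds: "t \<le> k" "k \<le> D" for k
  proof -
    have "t \<le> D" "D + k - t \<le> 2 * D" using k_bounds by simp_all
    from ex_in_pair_orbit[OF this(1) k_bounds(1) this(2)]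
    obtain u v where orbit_t: "(u, v) \<in> pair_orbit {1..2 * D} D k t" by blast
    then have subset_S: "u \<in> Pow {1..2 * D}" "v \<in> Pow {1..2 * D}" by (auto simp: pair_orbit_def)
    have orbit_reflected: "({1..2 * D} - u, v) \<in> pair_orbit {1..2 * D} D k (k - t)"
      using pair_orbit_Diff[OF _ orbit_t] by simp
    have "K ({1..2 * D} - u) v = K u v" using complement subset_S by simp
    moreover have "K v ({1..2 * D} - u) = K v u"
      using calculation psd_kernel_commute[OF psd] subset_S by auto
    ultimately show "y D k (k - t) = y D k t" "y k D (k - t) = y k D t"
      using orbit[OF orbit_t] orbit[OF orbit_reflected]
        orbit[OF orbit_t[THEN pair_orbit_swap[THEN iffD1]]]
        orbit[OF orbit_reflected[THEN pair_orbit_swap[THEN iffD1]]] by simp_all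
  qed
  show ?thesis using assms reflect by (auto simp: min_def)
qed

lemma sdp_block_eq:
  assumes ij_le: "i \<le> D" "j \<le> D" and r_le: "r \<le> i" "r \<le> j" "i = D \<or> j = D \<Longrightarrow> even r"
  shows "sdp_block D r y i j
    = block_factor D r i j * (\<Sum>t = 0..min i j. orbit_coeff (2 * D) r i j t * y i j t)"
proof (cases "i = D \<or> j = D")
  case True
  let ?n = "min i j" and ?F = "\<lambda>t. orbit_coeff (2 * D) r i j t * y i j t"
  have "sdp_block D r y i j
      = (\<Sum>t = (?n + 1) div 2..?n. block_factor D r i j * ((if 2 * t = ?n then 1 else 2) * ?F t))"
    unfolding sdp_block_def index_set_slice[OF dimension ij_le]
    by (rule sum.cong) (use True ij_le r_le in \<open>auto simp: beta_eq_orbit_coeff_boundary\<close>)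
  also have "\<dots> = block_factor D r i j
      * (\<Sum>t = (?n + 1) div 2..?n. (if 2 * t = ?n then 1 else 2) * ?F t)"
    by (simp only: sum_distrib_left)
  also have "(\<Sum>t = (?n + 1) div 2..?n. (if 2 * t = ?n then 1 else 2) * ?F t) = (\<Sum>t = 0..?n. ?F t)"
    using orbit_coeff_reflect_half[OF _ _ True ij_le, of r] orbit_value_reflect[OF True ij_le]
      True ij_le r_le
    by (intro sum_fold_half) simp
  finally show ?thesis .
next
  case False
  then show ?thesis
    unfolding sdp_block_def index_set_slice[OF dimension ij_le]
    using ij_le r_le by (simp add: block_factor_def beta_eq_orbit_coeff_interior)
qed

lemma psd_kernel_orbit_sum:
  assumes "r \<le> D"
  shows "psd_kernel J (\<lambda>i j. \<Sum>t = 0..min i j. orbit_coeff (2 * D) r i j t * y i j t)"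
proof -
  interpret point_pairs "{1..2 * D}" "{1..r}" id "\<lambda>k. k + r"
    using assms by (intro point_pairs_interval) simp
  let ?Q = "\<lambda>i j. \<Sum>u\<in>Pow {1..2 * D}. \<Sum>v\<in>Pow {1..2 * D}.
    (of_bool (card u = i) * pair_sign u) * K u v * (of_bool (card v = j) * pair_sign v)"
  have "?Q i j = 2 ^ r * (\<Sum>t = 0..min i j. orbit_coeff (2 * D) r i j t * y i j t)" for i j
    using sum_pair_sign_kernel[of K y i j, OF orbit] unfolding card_atLeastAtMost diff_Suc_1 by simp
  then have "1 / 2 ^ r * ?Q i j = (\<Sum>t = 0..min i j. orbit_coeff (2 * D) r i j t * y i j t)" for i j
    by simp
  moreover have "psd_kernel J (\<lambda>i j. 1 / 2 ^ r * ?Q i j)"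
    by (intro psd_kernel_mult_left psd_kernel_congruence psd) simp
  ultimately show ?thesis by (simp only:)
qed

lemma psd_on_sdp_block:
  assumes r_le: "r \<le> D" and J_eq: "J = (if even r then {r..D} else {r..D - 1})"
  shows "psd_on J (sdp_block D r y)"
proof -
  let ?M = "\<lambda>i j. \<Sum>t = 0..min i j. orbit_coeff (2 * D) r i j t * y i j t"
  have psd_M: "psd_kernel J ?M" using psd_kernel_orbit_sum[OF r_le] .
  have "sdp_block D r y i j = block_factor D r i j * ?M i j" if "i \<in> J" "j \<in> J" for i j
    using that J_eq dimension by (intro sdp_block_eq) (auto split: if_splits)
  then have "psd_on J (sdp_block D r y) \<longleftrightarrow> psd_kernel J (\<lambda>i j. block_factor D r i j * ?M i j)"
    unfolding psd_on_iff_psd_kernel by (rule psd_kernel_cong)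
  also have "\<dots>"
  proof (cases "r = D")
    case True
    then have "J = {D}" using J_eq dimension by simp
    then have "psd_kernel J (\<lambda>i j. block_factor D r i j * ?M i j)
        \<longleftrightarrow> psd_kernel J (\<lambda>i j. 1 / 2 * ?M i j)"
      using True by (intro psd_kernel_cong) (simp add: block_factor_def)
    then show ?thesis using psd_kernel_mult_left[OF psd_M, of "1 / 2"] by simp
  next
    case False
    \<comment> \<open>doubling the \<open>(D, D)\<close> entry adds a principal submatrix\<close>
    have "block_factor D r i j * ?M i j
        = ?M i j + of_bool (i = D) * ?M i j * of_bool (j = D)" for i j
      using False r_le by (simp add: block_factor_def)
    then show ?thesis using psd_kernel_add[OF psd_M psd_kernel_rescale[OF psd_M]] by simp
  qed
  finally show ?thesis .
qed

end

section \<open>The feasible point of an antipodal code\<close>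

lemma mset_triple_eqD:
  assumes "mset [a, b, c] = mset [i, j, k]"
  shows "(a = i \<and> b = j \<and> c = k) \<or> (a = j \<and> b = i \<and> c = k) \<or> (a = i \<and> b = k \<and> c = j)
    \<or> (a = k \<and> b = i \<and> c = j) \<or> (a = j \<and> b = k \<and> c = i) \<or> (a = k \<and> b = j \<and> c = i)"
  using assms by (auto simp: add_eq_conv_ex)

locale antipodal_code =
  fixes D :: nat and B :: "nat set set"
  assumes dimension: "2 \<le> D" "even D"
    and B_subset: "B \<subseteq> Pow {1..2 * D}" and nonempty: "B \<noteq> {}"
    and antipode: "\<And>b. b \<in> B \<Longrightarrow> {1..2 * D} - b \<in> B"
begin

abbreviation S where "S \<equiv> {1..2 * D}"

abbreviation W where "W \<equiv> code_kernel S B B"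

definition point :: "nat \<Rightarrow> nat \<Rightarrow> nat \<Rightarrow> real" where
  "point i j t = W {1..i} ({1..t} \<union> {i + 1..i + j - t})"

lemma finite_B: "finite B"
  using B_subset finite_subset by blast

lemma card_Diff_S:
  assumes "u \<subseteq> S"
  shows "card (S - u) = 2 * D - card u"
  using card_Diff_subset[OF finite_subset[OF assms] assms] by simp

lemma W_complement: "u \<subseteq> S \<Longrightarrow> W (S - u) v = W u v"
  by (rule code_kernel_complement[OF B_subset antipode])

lemma point_eq:
  assumes uv_orbit: "(u, v) \<in> pair_orbit S i j t"
  shows "point i j t = W u v"
proof -
  have "t \<le> i" "t \<le> j" "i + j - t \<le> 2 * D"
    using pair_orbit_bounds[OF _ uv_orbit] by simp_all
  from code_kernel_cong_orbit[OF _ ex_in_pair_orbit[OF this] uv_orbit]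
  show ?thesis unfolding point_def by simp
qed

lemma index_set_orbit:
  assumes "(i, j, t) \<in> index_set D"
  obtains u v where "(u, v) \<in> pair_orbit S i j t"
  using ex_in_pair_orbit[OF index_setD(1,2,5)[OF assms]] that by blast

lemma point_empty:
  assumes "w \<subseteq> S"
  shows "point (card w) 0 0 = W w {}" "point (2 * D - card w) 0 0 = W w {}"
proof -
  show "point (card w) 0 0 = W w {}"
    using assms by (intro point_eq) (simp add: pair_orbit_def)
  have "point (2 * D - card w) 0 0 = W (S - w) {}"
    using card_Diff_S[OF assms] by (intro point_eq) (simp add: pair_orbit_def)
  then show "point (2 * D - card w) 0 0 = W w {}"
    using W_complement[OF assms] by simp
qed

lemma point_nonneg: "0 \<le> point i j t"
  unfolding point_def by (rule code_kernel_nonneg)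

lemma point_0: "point 0 0 0 = 1"
  using code_kernel_empty_empty[OF _ finite_B nonempty, of S] by (simp add: point_def)

lemma point_le:
  assumes "(i, j, t) \<in> index_set D"
  shows "point i j t \<le> point i 0 0"
proof -
  obtain u v where uv_orbit: "(u, v) \<in> pair_orbit S i j t" using index_set_orbit[OF assms] .
  then have "point i 0 0 = W u {}" using point_empty(1)[of u] by (simp add: pair_orbit_def)
  then show ?thesis using point_eq[OF uv_orbit] code_kernel_le_empty[OF finite_B] by simp
qed

text \<open>
  The side lengths of such a triangle are permuted by condition (3) of the program if \<open>T = {}\<close>, and
  by condition (4) if \<open>T = S\<close>.
\<close>

definition triangle :: "nat set \<Rightarrow> nat set \<Rightarrow> nat set \<Rightarrow> nat set \<Rightarrow> bool" where
  "triangle T a b c \<longleftrightarrow> a \<subseteq> S \<and> b \<subseteq> S \<and> c \<subseteq> S \<and> sym_diff (sym_diff a b) c = T"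

lemma triangle_swap:
  assumes "triangle T a b c"
  shows "triangle T b a c" "triangle T a c b"
proof -
  have "sym_diff (sym_diff b a) c = sym_diff (sym_diff a b) c"
    "sym_diff (sym_diff a c) b = sym_diff (sym_diff a b) c" by blast+
  then show "triangle T b a c" "triangle T a c b"
    using assms unfolding triangle_def by simp_all
qed

lemma W_triangle:
  assumes "triangle T a b c" "T \<in> {{}, S}"
  shows "W a c = W a b"
proof -
  have sym_diff_subset: "sym_diff b a \<subseteq> S" using assms unfolding triangle_def by blast
  have "W c a = W (sym_diff b a) a"
    using assms(2)
  proof (elim insertE emptyE)
    assume "T = {}"
    then have "c = sym_diff b a" using assms(1) unfolding triangle_def by blast
    then show ?thesis by simp
  next
    assume "T = S"
    then have "c = S - sym_diff b a" using assms(1) unfolding triangle_def by blast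
    then show ?thesis using W_complement[OF sym_diff_subset] by simp
  qed
  also have "\<dots> = W b a" by (rule code_kernel_sym_diff)
  finally show ?thesis by (simp only: code_kernel_commute)
qed

lemma triangle_permute:
  assumes abc: "triangle T a b c" and T_cases: "T \<in> {{}, S}"
    and perm: "mset [i, j, k] = mset [card a, card b, card c]"
  obtains a' b' c' where "triangle T a' b' c'"
    "card a' = i" "card b' = j" "card c' = k" "W a' b' = W a b"
proof -
  note swap = triangle_swap
  have bac: "triangle T b a c" and acb: "triangle T a c b" using swap[OF abc] .
  have bca: "triangle T b c a" and cab: "triangle T c a b" using swap(2)[OF bac] swap(1)[OF acb] .
  have cba: "triangle T c b a" using swap(2)[OF cab] .
  have ba: "W b a = W a b" by (rule code_kernel_commute)
  have ac: "W a c = W a b" and bc: "W b c = W a b"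
    using W_triangle[OF abc T_cases] W_triangle[OF bac T_cases] ba by simp_all
  have ca: "W c a = W a b" and cb: "W c b = W a b"
    using ac bc code_kernel_commute by metis+
  from mset_triple_eqD[OF perm] show thesis
    by (elim disjE conjE) (use that abc bac acb bca cab cba ba ac bc ca cb in metis)+
qed

lemma point_eq_permute:
  assumes uv_orbit: "(u, v) \<in> pair_orbit S i j t" and uvw: "triangle T u v w"
    and T_cases: "T \<in> {{}, S}"
    and perm: "mset [i', j', k'] = mset [i, j, card w]"
    and t'_le: "t' \<le> i'" "t' \<le> j'"
    and third_side: "\<And>a b c. triangle T a b c \<Longrightarrow> card c = k'
      \<Longrightarrow> card (sym_diff a b) = i' + j' - 2 * t'"
  shows "point i j t = point i' j' t'"
proof -
  have "card u = i" "card v = j" using uv_orbit by (simp_all add: pair_orbit_def)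
  then obtain a b c where abc: "triangle T a b c"
    and cards: "card a = i'" "card b = j'" "card c = k'"
    and kernel_eq: "W a b = W u v"
    using triangle_permute[OF uvw T_cases, of i' j' k'] perm by metis
  have "(a, b) \<in> pair_orbit S (card a) (card b) t'"
    using abc third_side[OF abc cards(3)] t'_le cards unfolding triangle_def
    by (intro in_pair_orbit_if_card_sym_diff) simp_all
  then have "point i' j' t' = W a b" using cards by (intro point_eq) simp
  then show ?thesis using kernel_eq point_eq[OF uv_orbit] by simp
qed

lemma point_permute:
  assumes index: "(i, j, t) \<in> index_set D" and index': "(i', j', t') \<in> index_set D"
    and perm: "mset [i', j', i' + j' - 2 * t'] = mset [i, j, i + j - 2 * t]"
  shows "point i j t = point i' j' t'"
proof -
  obtain u v where uv_orbit: "(u, v) \<in> pair_orbit S i j t" using index_set_orbit[OF index] .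
  show ?thesis
  proof (rule point_eq_permute[OF uv_orbit])
    show "triangle {} u v (sym_diff u v)"
      using uv_orbit unfolding triangle_def pair_orbit_def by blast
    show "mset [i', j', i' + j' - 2 * t'] = mset [i, j, card (sym_diff u v)]"
      using perm card_sym_diff_pair_orbit[OF _ uv_orbit] by simp
    show "card (sym_diff a b) = i' + j' - 2 * t'"
      if "triangle {} a b c" "card c = i' + j' - 2 * t'" for a b c
    proof -
      have "sym_diff a b = c" using that(1) unfolding triangle_def by blast
      then show ?thesis using that(2) by simp
    qed
  qed (use index_setD[OF index'] in simp_all)
qed

lemma point_permute_antipode:
  assumes index: "(i, j, t) \<in> index_set D" and index': "(i', j', t') \<in> index_set D"
    and perm: "mset [i', j', 2 * D - (i' + j' - 2 * t')] = mset [i, j, 2 * D - (i + j - 2 * t)]"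
  shows "point i j t = point i' j' t'"
proof -
  obtain u v where uv_orbit: "(u, v) \<in> pair_orbit S i j t" using index_set_orbit[OF index] .
  have sym_diff_subset: "sym_diff u v \<subseteq> S" using uv_orbit unfolding pair_orbit_def by blast
  show ?thesis
  proof (rule point_eq_permute[OF uv_orbit])
    have "sym_diff (sym_diff u v) (S - sym_diff u v) = S" using sym_diff_subset by blast
    then show "triangle S u v (S - sym_diff u v)"
      using uv_orbit unfolding triangle_def pair_orbit_def by simp
    show "mset [i', j', 2 * D - (i' + j' - 2 * t')] = mset [i, j, card (S - sym_diff u v)]"
      using perm card_sym_diff_pair_orbit[OF _ uv_orbit] card_Diff_S[OF sym_diff_subset] by simp
    show "card (sym_diff a b) = i' + j' - 2 * t'"
      if abc_triangle: "triangle S a b c"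
        and card_c: "card c = 2 * D - (i' + j' - 2 * t')" for a b c
    proof -
      have "c \<subseteq> S" "sym_diff a b = S - c" using abc_triangle unfolding triangle_def by blast+
      then have "card (sym_diff a b) = 2 * D - (2 * D - (i' + j' - 2 * t'))"
        using card_Diff_S card_c by simp
      then show ?thesis using index_setD(3,4)[OF index'] by simp
    qed
  qed (use index_setD[OF index'] in simp_all)
qed

lemma point_zeta:
  assumes uv_orbit: "(u, v) \<in> pair_orbit S i j t"
  shows "point (zeta D i j t) 0 0 = W (sym_diff u v) {}"
proof -
  have "sym_diff u v \<subseteq> S" using uv_orbit unfolding pair_orbit_def by blast
  note empty = point_empty[OF this]
  have "card (sym_diff u v) = i + j - 2 * t" using card_sym_diff_pair_orbit[OF _ uv_orbit] by simp
  from empty[unfolded this] show ?thesis unfolding zeta_def min_def by presburger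
qed

lemma antipodal_kernel_W: "antipodal_kernel D W point"
proof
  show "psd_kernel (Pow S) W" by (rule psd_kernel_code_kernel[OF finite_B])
  show "W u v = point i j t" if "(u, v) \<in> pair_orbit S i j t" for i j t u v
    using point_eq[OF that] ..
qed (rule dimension W_complement; assumption?)+

lemma antipodal_kernel_Pow_Diff:
  "antipodal_kernel D (code_kernel S (Pow S - B) B)
    (\<lambda>i j t. point (zeta D i j t) 0 0 - point i j t)"
proof
  show "psd_kernel (Pow S) (code_kernel S (Pow S - B) B)" by (rule psd_kernel_code_kernel) simp
  show "code_kernel S (Pow S - B) B u v = point (zeta D i j t) 0 0 - point i j t"
    if uv_orbit: "(u, v) \<in> pair_orbit S i j t" for i j t u v
  proof -
    have "v \<subseteq> S" using uv_orbit by (simp add: pair_orbit_def)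
    then show ?thesis
      unfolding point_zeta[OF uv_orbit] point_eq[OF uv_orbit]
      by (intro code_kernel_Pow_Diff[OF _ B_subset]) simp_all
  qed
  show "code_kernel S (Pow S - B) B (S - u) v = code_kernel S (Pow S - B) B u v" if "u \<subseteq> S" for u v
    by (rule code_kernel_complement[OF _ antipode that]) blast
qed (rule dimension)+

lemma psd_on_blocks:
  assumes "r \<le> D" "J = (if even r then {r..D} else {r..D - 1})"
  shows "psd_on J (block1 D point r)" "psd_on J (block2 D point r)"
  unfolding block1_eq_sdp_block block2_eq_sdp_block
  using antipodal_kernel.psd_on_sdp_block[OF antipodal_kernel_W assms]
    antipodal_kernel.psd_on_sdp_block[OF antipodal_kernel_Pow_Diff assms] .

lemma sdp_objective_point: "2 * sdp_objective D point = card B"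
proof -
  let ?T = "\<lambda>i. real (2 * D choose i) * point i 0 0"
  have reflect: "?T (2 * D - i) = ?T i" if "i \<le> 2 * D" for i
    using point_empty[of "{1..i}"] that by (simp add: binomial_symmetric[symmetric])
  have "real (card B) = (\<Sum>u\<in>Pow S. W u {})"
    using sum_code_kernel_empty[OF _ B_subset] by simp
  also have "\<dots> = (\<Sum>u\<in>Pow S. point (card u) 0 0)"
    by (intro sum.cong refl) (simp add: point_empty(1))
  also have "\<dots> = (\<Sum>i = 0..2 * D. ?T i)"
    by (subst sum_Pow_card) auto
  also have "\<dots> = (\<Sum>i = D + 1..2 * D. ?T i + ?T (2 * D - i)) + ?T D"
    by (subst sum_split_half) simp
  also have "(\<Sum>i = D + 1..2 * D. ?T i + ?T (2 * D - i)) = (\<Sum>i = 0..D - 1. 2 * ?T i)"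
    by (rule sum.reindex_bij_witness[where i = "\<lambda>i. 2 * D - i" and j = "\<lambda>i. 2 * D - i"])
      (use reflect dimension in auto)
  finally show ?thesis
    by (simp add: sdp_objective_def sum_distrib_left)
qed

end

locale separated_antipodal_code = antipodal_code +
  fixes d :: nat
  assumes separated: "\<And>a b. a \<in> B \<Longrightarrow> b \<in> B \<Longrightarrow> 0 < card (sym_diff a b)
    \<Longrightarrow> card (sym_diff a b) < 2 * D \<Longrightarrow> d \<le> card (sym_diff a b)"
begin

lemma separated_cases:
  assumes ab_in: "a \<in> B" "b \<in> B"
  shows "card (sym_diff a b) \<in> {0, 2 * D}
    \<or> d \<le> card (sym_diff a b) \<and> d \<le> 2 * D - card (sym_diff a b)"
proof (cases "card (sym_diff a b) \<in> {0, 2 * D}")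
  case False
  have sym_diff_subset: "sym_diff a b \<subseteq> S" using ab_in B_subset by blast
  have "card (sym_diff a b) \<le> card S" by (rule card_mono[OF _ sym_diff_subset]) simp
  then have range: "0 < card (sym_diff a b)" "card (sym_diff a b) < 2 * D" using False by auto
  have "sym_diff a (S - b) = S - sym_diff a b" using ab_in B_subset by blast
  then have "card (sym_diff a (S - b)) = 2 * D - card (sym_diff a b)"
    using card_Diff_S[OF sym_diff_subset] by simp
  then show ?thesis
    using separated[OF ab_in range] separated[OF ab_in(1) antipode[OF ab_in(2)]] range by simp
qed simp

lemma point_eq_0:
  assumes index: "(i, j, t) \<in> index_set D" and nonzero_index: "(i, j, t) \<noteq> (0, 0, 0)"
    and short: "{i, j, i + j - 2 * t, 2 * D - (i + j - 2 * t)} \<inter> {1..d - 1} \<noteq> {}"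
  shows "point i j t = 0"
proof (rule ccontr)
  assume nonzero: "point i j t \<noteq> 0"
  let ?k = "i + j - 2 * t"
  obtain u v where uv_orbit: "(u, v) \<in> pair_orbit S i j t" using index_set_orbit[OF index] .
  then have "card u = i" "card v = j" "card (sym_diff u v) = ?k"
    using card_sym_diff_pair_orbit[OF _ uv_orbit] by (simp_all add: pair_orbit_def)
  moreover have "W u v \<noteq> 0" using nonzero point_eq[OF uv_orbit] by simp
  ultimately obtain a b c where abc_code: "a \<in> B" "b \<in> B" "c \<in> B"
    "card (sym_diff a b) = i" "card (sym_diff a c) = j" "card (sym_diff b c) = ?k"
    by (metis code_kernel_nonzeroE)
  note bounds = index_setD[OF index]
  have i_cases: "i = 0 \<or> d \<le> i" and j_cases: "j = 0 \<or> d \<le> j"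
    using separated_cases[OF abc_code(1,2)] separated_cases[OF abc_code(1,3)]
      abc_code(4,5) bounds(3,4) dimension by auto
  have "?k \<noteq> 2 * D"
    using index dimension unfolding index_set_def by auto
  then have k_cases: "?k = 0 \<or> d \<le> ?k \<and> d \<le> 2 * D - ?k"
    using separated_cases[OF abc_code(2,3)] abc_code(6) by auto
  show False
  proof (cases "?k = 0")
    case True
    then have "i = t" "j = t" using bounds(1,2) by simp_all
    then show False using True nonzero_index short i_cases bounds(3) by auto
  next
    case False
    then show False using short i_cases j_cases k_cases by auto
  qed
qed

lemma sdp_feasible_point: "sdp_feasible D d point"
  unfolding sdp_feasible_def
proof (intro conjI)
  show "\<forall>(i, j, t) \<in> index_set D. 0 \<le> point i j t \<and> point i j t \<le> point i 0 0"
    using point_nonneg point_le by blast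
  show "\<forall>(i, j, t) \<in> index_set D. \<forall>(i', j', t') \<in> index_set D.
        i + j - 2 * t \<le> D \<and> mset [i', j', i' + j' - 2 * t'] = mset [i, j, i + j - 2 * t]
        \<longrightarrow> point i j t = point i' j' t'"
    using point_permute by blast
  show "\<forall>(i, j, t) \<in> index_set D. \<forall>(i', j', t') \<in> index_set D.
        D + 1 \<le> i + j - 2 * t \<and> i + j - 2 * t \<le> 2 * D - 2
        \<and> mset [i', j', 2 * D - (i' + j' - 2 * t')] = mset [i, j, 2 * D - (i + j - 2 * t)]
        \<longrightarrow> point i j t = point i' j' t'"
    using point_permute_antipode by blast
  show "\<forall>(i, j, t) \<in> index_set D.
        (i, j, t) \<noteq> (0, 0, 0)
        \<and> {i, j, i + j - 2 * t, 2 * D - (i + j - 2 * t)} \<inter> {1..d - 1} \<noteq> {}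
        \<longrightarrow> point i j t = 0"
    using point_eq_0 by blast
  show "\<forall>r \<in> {0..D}. even r \<longrightarrow> psd_on {r..D} (block1 D point r) \<and> psd_on {r..D} (block2 D point r)"
    by (intro ballI impI conjI psd_on_blocks) auto
  show "\<forall>r \<in> {1..D - 1}. odd r \<longrightarrow>
        psd_on {r..D - 1} (block1 D point r) \<and> psd_on {r..D - 1} (block2 D point r)"
    by (intro ballI impI conjI psd_on_blocks) auto
qed (rule point_0)

lemma half_card_le_sdp_value: "ereal (card B / 2) \<le> sdp_value D d"
proof -
  have "ereal (sdp_objective D point) \<le> sdp_value D d"
    unfolding sdp_value_def using sdp_feasible_point by (intro SUP_upper) simp
  moreover have "sdp_objective D point = card B / 2" using sdp_objective_point by simp
  ultimately show ?thesis by (simp only:)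
qed

end

section \<open>Codes in the folded cube\<close>

lemma folded_cube_vertices_eq:
  "folded_cube_vertices D = (\<lambda>u. {u, {1..2 * D} - u}) ` Pow {1..2 * D}"
proof (intro set_eqI iffI)
  fix x assume "x \<in> folded_cube_vertices D"
  then obtain u u' where x_eq: "x = {u, u'}" "u \<inter> u' = {}" "u \<union> u' = {1..2 * D}"
    unfolding folded_cube_vertices_def by blast
  then have "u' = {1..2 * D} - u" by blast
  then show "x \<in> (\<lambda>u. {u, {1..2 * D} - u}) ` Pow {1..2 * D}" using x_eq by blast
next
  fix x assume "x \<in> (\<lambda>u. {u, {1..2 * D} - u}) ` Pow {1..2 * D}"
  then obtain u where "u \<subseteq> {1..2 * D}" "x = {u, {1..2 * D} - u}" by blast
  then show "x \<in> folded_cube_vertices D" unfolding folded_cube_vertices_def by blast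
qed

lemma folded_cube_vertex_eq:
  assumes "x \<in> folded_cube_vertices D" "u \<in> x"
  shows "u \<subseteq> {1..2 * D}" "x = {u, {1..2 * D} - u}"
  using assms unfolding folded_cube_vertices_eq by auto

lemma folded_cube_dist_le:
  assumes "x \<in> folded_cube_vertices D" "y \<in> folded_cube_vertices D" "u \<in> x" "v \<in> y"
  shows "folded_cube_dist x y \<le> card (sym_diff u v)"
proof -
  note x_eq = folded_cube_vertex_eq[OF assms(1,3)] and y_eq = folded_cube_vertex_eq[OF assms(2,4)]
  have "folded_cube_dist {u, {1..2 * D} - u} {v, {1..2 * D} - v} \<le> card (sym_diff u v)"
    using x_eq(1) y_eq(1) by (subst folded_cube_dist_eq_min[of _ _ D]) auto
  then show ?thesis using x_eq(2) y_eq(2) by simp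
qed

lemma card_folded_cube_vertex:
  assumes "0 < D" "x \<in> folded_cube_vertices D"
  shows "card x = 2"
proof -
  obtain u where "x = {u, {1..2 * D} - u}"
    using assms(2) unfolding folded_cube_vertices_eq by blast
  moreover have "1 \<in> {1..2 * D}" using assms(1) by simp
  then have "u \<noteq> {1..2 * D} - u" by blast
  ultimately show ?thesis by simp
qed

lemma card_Union_folded_cube:
  assumes D_pos: "0 < D" and C_vertices: "C \<subseteq> folded_cube_vertices D"
  shows "card (\<Union>C) = 2 * card C"
proof -
  have card: "card x = 2" if "x \<in> C" for x
    using card_folded_cube_vertex[OF D_pos] C_vertices that by blast
  have "pairwise disjnt C"
  proof (rule pairwiseI)
    fix x y assume xy_in: "x \<in> C" "y \<in> C" "x \<noteq> y"
    have "x = y" if "z \<in> x" "z \<in> y" for z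
      using folded_cube_vertex_eq(2)[of _ D z] xy_in(1,2) C_vertices that by blast
    then show "disjnt x y" using xy_in(3) unfolding disjnt_def by blast
  qed
  moreover have "finite x" if "x \<in> C" for x
    using card[OF that] by (intro card_ge_0_finite) simp
  ultimately show ?thesis using card card_Union_disjoint[of C] by simp
qed

lemma separated_antipodal_code_Union:
  assumes dimension: "2 \<le> D" "even D"
    and code: "is_code (folded_cube_vertices D) folded_cube_dist d C" "C \<noteq> {}"
  shows "separated_antipodal_code D (\<Union>C) d"
proof
  let ?S = "{1..2 * D}"
  have vertex: "x \<in> folded_cube_vertices D" if "x \<in> C" for x
    using code(1) that by (auto simp: is_code_def)
  show "\<Union>C \<subseteq> Pow ?S" "\<Union>C \<noteq> {}"
    using vertex code(2) unfolding folded_cube_vertices_eq by blast+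
  show "?S - b \<in> \<Union>C" if "b \<in> \<Union>C" for b
    using that folded_cube_vertex_eq(2)[OF vertex] by blast
  show "d \<le> card (sym_diff a b)"
    if ab_in: "a \<in> \<Union>C" "b \<in> \<Union>C"
      and far: "0 < card (sym_diff a b)" "card (sym_diff a b) < 2 * D" for a b
  proof -
    obtain x y where xy_in: "x \<in> C" "a \<in> x" "y \<in> C" "b \<in> y" using ab_in by blast
    have "x \<noteq> y"
    proof
      assume "x = y"
      note a_vertex = folded_cube_vertex_eq[OF vertex[OF xy_in(1)] xy_in(2)]
      have "b = a \<or> b = ?S - a" using xy_in(4) a_vertex(2) \<open>x = y\<close> by blast
      moreover have "sym_diff a (?S - a) = ?S" using a_vertex(1) by blast
      ultimately show False using far by auto
    qed
    then have "d \<le> folded_cube_dist x y" using code(1) xy_in by (simp add: is_code_def)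
    also have "\<dots> \<le> card (sym_diff a b)" using folded_cube_dist_le vertex xy_in by blast
    finally show ?thesis .
  qed
qed (rule dimension)+

lemma max_code_size_attained:
  assumes V_vertex: "finite V" "v \<in> V"
  obtains C where "is_code V dst d C" "C \<noteq> {}" "card C = max_code_size V dst d"
proof -
  let ?N = "{card C | C. is_code V dst d C}"
  have "?N \<subseteq> card ` Pow V" by (auto simp: is_code_def)
  then have fin: "finite ?N" using V_vertex finite_subset by blast
  have "is_code V dst d {v}" using V_vertex by (simp add: is_code_def)
  then have "card {v} \<in> ?N" by blast
  then have one: "1 \<in> ?N" by simp
  then have "max_code_size V dst d \<in> ?N"
    unfolding max_code_size_def using fin by (intro Max_in) auto
  then obtain C where C_max: "is_code V dst d C" "card C = max_code_size V dst d" by auto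
  have "1 \<le> max_code_size V dst d" unfolding max_code_size_def using fin one by (intro Max_ge)
  then have "C \<noteq> {}" using C_max by auto
  then show thesis using C_max that by blast
qed

theorem theorem5p3:
  fixes D d :: nat
  assumes "2 \<le> D" and "even D" and "0 < d"
  shows "ereal (real (max_code_size (folded_cube_vertices D) folded_cube_dist d)) \<le> sdp_value D d"
proof -
  let ?V = "folded_cube_vertices D"
  have "finite ?V" "{{}, {1..2 * D} - {}} \<in> ?V" unfolding folded_cube_vertices_eq by auto
  then obtain C where code: "is_code ?V folded_cube_dist d C" "C \<noteq> {}"
    and card_C: "card C = max_code_size ?V folded_cube_dist d"
    by (rule max_code_size_attained)
  then interpret separated_antipodal_code D "\<Union>C" d
    using assms by (intro separated_antipodal_code_Union)
  have "card (\<Union>C) = 2 * card C"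
    using code(1) assms(1) by (intro card_Union_folded_cube[of D]) (simp_all add: is_code_def)
  then show ?thesis using half_card_le_sdp_value card_C by simp
qed

end
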